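(* There is a universal constant $\mu>1$ and a family $(G_n:n\in\mathbb{N})$ of quasi-line graphs of maximum degree at most $8$, with $|V(G_n)|=18n$, such that the mixing time of Glauber dynamics for the Ising model $(G_n,\mu)$ is $\Omega(2^n)$.
   Context: Graphs are finite and simple. For a graph $G$ and $\sigma:V(G)\to\{+,-\}$, let $\mathrm{cut}\,\sigma=\{\{u,v\}\in E(G):\sigma(u)\ne\sigma(v)\}$ and $\mathrm{wt}\,\sigma=\mu^{|\mathrm{cut}\,\sigma|}$; the Gibbs distribution of the Ising instance $(G,\mu)$ assigns probability $\mathrm{wt}\,\sigma/Z(G,\mu)$ to $\sigma$, where $Z(G,\mu)=\sum_{\sigma}\mathrm{wt}\,\sigma$. Glauber dynamics is the Markov chain on $\{+,-\}^{V(G)}$ which, from state $X_t=\sigma$, picks $v\in V(G)$ uniformly at random, lets $\sigma'$ agree with $\sigma$ except $\sigma'(v)=-\sigma(v)$, and sets $X_{t+1}=\sigma'$ with probability $\mathrm{wt}\,\sigma'/(\mathrm{wt}\,\sigma+\mathrm{wt}\,\sigma')$ and $X_{t+1}=\sigma$ otherwise. The mixing time is the maximum over starting states $\omega$ of the least $t$ such that the law of $X_t$ given $X_0=\omega$ is within total variation distance $\tfrac14$ of the Gibbs distribution. A graph is quasi-line if for every vertex $v$ the neighbours of $v$ can be partitioned into two sets each inducing a clique. *)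

theory Defs
  imports "HOL-Probability.Probability" "HOL-Library.Landau_Symbols"
begin

record 'a ugraph =
  verts :: "'a set"
  edges :: "'a set set"

definition simple_graph :: "'a ugraph \<Rightarrow> bool" where
  "simple_graph G \<longleftrightarrow>
     finite (verts G) \<and> edges G \<subseteq> {{u, v} | u v. u \<in> verts G \<and> v \<in> verts G \<and> u \<noteq> v}"

definition neighbours :: "'a ugraph \<Rightarrow> 'a \<Rightarrow> 'a set" where
  "neighbours G v = {u \<in> verts G. {v, u} \<in> edges G}"

definition vertex_degree :: "'a ugraph \<Rightarrow> 'a \<Rightarrow> nat" where
  "vertex_degree G v = card (neighbours G v)"

definition clique :: "'a ugraph \<Rightarrow> 'a set \<Rightarrow> bool" where
  "clique G A \<longleftrightarrow> A \<subseteq> verts G \<and> (\<forall>u\<in>A. \<forall>v\<in>A. u \<noteq> v \<longrightarrow> {u, v} \<in> edges G)"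

text \<open>The two parts are allowed to be empty.\<close>

definition quasi_line :: "'a ugraph \<Rightarrow> bool" where
  "quasi_line G \<longleftrightarrow>
     (\<forall>v\<in>verts G. \<exists>A B. A \<union> B = neighbours G v \<and> A \<inter> B = {} \<and> clique G A \<and> clique G B)"

text \<open>
  Spins are booleans, \<open>True\<close> standing for \<open>+\<close>. Configurations are extensional functions, so that
  they are in bijection with the maps from the vertex set to the two spins.
\<close>

definition configs :: "'a ugraph \<Rightarrow> ('a \<Rightarrow> bool) set" where
  "configs G = verts G \<rightarrow>\<^sub>E UNIV"

definition cut :: "'a ugraph \<Rightarrow> ('a \<Rightarrow> bool) \<Rightarrow> 'a set set" where
  "cut G \<sigma> = {{u, v} | u v. {u, v} \<in> edges G \<and> \<sigma> u \<noteq> \<sigma> v}"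

definition wt :: "'a ugraph \<Rightarrow> real \<Rightarrow> ('a \<Rightarrow> bool) \<Rightarrow> real" where
  "wt G \<mu> \<sigma> = \<mu> ^ card (cut G \<sigma>)"

definition partition_function :: "'a ugraph \<Rightarrow> real \<Rightarrow> real" where
  "partition_function G \<mu> = (\<Sum>\<sigma>\<in>configs G. wt G \<mu> \<sigma>)"

definition gibbs :: "'a ugraph \<Rightarrow> real \<Rightarrow> ('a \<Rightarrow> bool) pmf" where
  "gibbs G \<mu> =
     embed_pmf (\<lambda>\<sigma>. if \<sigma> \<in> configs G then wt G \<mu> \<sigma> / partition_function G \<mu> else 0)"

definition flip :: "('a \<Rightarrow> bool) \<Rightarrow> 'a \<Rightarrow> 'a \<Rightarrow> bool" where
  "flip \<sigma> v = \<sigma>(v := \<not> \<sigma> v)"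

text \<open>Meaningful only for a nonempty vertex set, since \<^const>\<open>pmf_of_set\<close> is unspecified on \<open>{}\<close>.\<close>

definition glauber_step :: "'a ugraph \<Rightarrow> real \<Rightarrow> ('a \<Rightarrow> bool) \<Rightarrow> ('a \<Rightarrow> bool) pmf" where
  "glauber_step G \<mu> \<sigma> = do {
     v \<leftarrow> pmf_of_set (verts G);
     accept \<leftarrow> bernoulli_pmf (wt G \<mu> (flip \<sigma> v) / (wt G \<mu> \<sigma> + wt G \<mu> (flip \<sigma> v)));
     return_pmf (if accept then flip \<sigma> v else \<sigma>)
   }"

definition glauber_law :: "'a ugraph \<Rightarrow> real \<Rightarrow> ('a \<Rightarrow> bool) \<Rightarrow> nat \<Rightarrow> ('a \<Rightarrow> bool) pmf" where
  "glauber_law G \<mu> \<omega> t = ((\<lambda>p. bind_pmf p (glauber_step G \<mu>)) ^^ t) (return_pmf \<omega>)"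

definition tv_dist :: "'a pmf \<Rightarrow> 'a pmf \<Rightarrow> real" where
  "tv_dist p q = (SUP A. \<bar>measure_pmf.prob p A - measure_pmf.prob q A\<bar>)"

text \<open>
  For \<open>\<mu> > 0\<close> and a finite nonempty vertex set the chain is irreducible and aperiodic on
  \<^const>\<open>configs\<close> with stationary distribution \<^const>\<open>gibbs\<close>, so the least time exists.
\<close>

definition mixing_time :: "'a ugraph \<Rightarrow> real \<Rightarrow> nat" where
  "mixing_time G \<mu> =
     Max ((\<lambda>\<omega>. LEAST t. tv_dist (glauber_law G \<mu> \<omega> t) (gibbs G \<mu>) \<le> 1 / 4) ` configs G)"

lemma finite_configs: "finite (verts G) \<Longrightarrow> finite (configs G)"
  unfolding configs_def by (intro finite_PiE) auto

lemma configs_nonempty: "configs G \<noteq> {}"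
  unfolding configs_def by (auto simp: PiE_eq_empty_iff)

lemma flip_in_configs: "\<sigma> \<in> configs G \<Longrightarrow> v \<in> verts G \<Longrightarrow> flip \<sigma> v \<in> configs G"
  unfolding configs_def flip_def by (auto simp: PiE_def extensional_def)

lemma wt_pos: "\<mu> > 0 \<Longrightarrow> wt G \<mu> \<sigma> > 0"
  by (simp add: wt_def)

lemma partition_function_pos:
  "finite (verts G) \<Longrightarrow> \<mu> > 0 \<Longrightarrow> partition_function G \<mu> > 0"
  unfolding partition_function_def
  by (intro sum_pos finite_configs configs_nonempty wt_pos)

lemma pmf_gibbs:
  assumes "finite (verts G)" "\<mu> > 0"
  shows "pmf (gibbs G \<mu>) \<sigma> =
    (if \<sigma> \<in> configs G then wt G \<mu> \<sigma> / partition_function G \<mu> else 0)"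
  unfolding gibbs_def
proof (rule pmf_embed_pmf)
  let ?f = "\<lambda>\<sigma>. if \<sigma> \<in> configs G then wt G \<mu> \<sigma> / partition_function G \<mu> else 0"
  have Z: "partition_function G \<mu> > 0" and w: "\<And>\<sigma>. wt G \<mu> \<sigma> > 0"
    using assms by (auto intro: partition_function_pos wt_pos)
  show nonneg: "?f \<sigma> \<ge> 0" for \<sigma>
    using Z less_imp_le[OF w] by simp
  have "(\<integral>\<^sup>+\<sigma>. ennreal (?f \<sigma>) \<partial>count_space UNIV) = (\<Sum>\<sigma>\<in>configs G. ennreal (?f \<sigma>))"
    using finite_configs[OF assms(1)]
    by (intro nn_integral_count_space') (auto split: if_splits)
  also have "\<dots> = ennreal (\<Sum>\<sigma>\<in>configs G. ?f \<sigma>)"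
    by (rule sum_ennreal) (rule nonneg)
  also have "(\<Sum>\<sigma>\<in>configs G. ?f \<sigma>) = (\<Sum>\<sigma>\<in>configs G. wt G \<mu> \<sigma> / partition_function G \<mu>)"
    by (intro sum.cong) auto
  also have "\<dots> = 1"
    using Z by (simp add: sum_divide_distrib[symmetric] partition_function_def[symmetric])
  finally show "(\<integral>\<^sup>+\<sigma>. ennreal (?f \<sigma>) \<partial>count_space UNIV) = 1" by simp
qed

end

theory Submission
  imports Defs "HOL-Combinatorics.Permutations"
begin

text \<open>
  Take a \<open>K\<^sub>4\<close> and a triangle sharing an edge. Its cuts have at most 6 edges, and a cut of size 6
  forces the three vertices off the shared edge (the ports) to have equal spins. So the gadget
  transmits one spin through three ports, and joining ports of different gadgets by single edges
  keeps the graph quasi-line. Gadgets are wired along an expander made of a bounded number of random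
  permutations of \<open>N\<close> columns, in such a way that a cut meeting all gadgets and links optimally is
  determined by one spin. If exactly \<open>s = N / 16\<close> columns have spin \<open>+\<close>, expansion produces at least
  \<open>s / 4\<close> defects, each costing a factor \<open>\<mu>\<close>. For large \<open>\<mu>\<close> this beats the number
  \<open>2\<^bsup>18n\<^esup>\<close> of configurations, so that the configurations with exactly \<open>s\<close> plus columns are a bottleneck
  separating the two ground states.
\<close>

section \<open>Glauber dynamics and bottlenecks\<close>

locale ising =
  fixes G :: "'a ugraph" and \<mu> :: real
  assumes finite_verts: "finite (verts G)" and verts_nonempty: "verts G \<noteq> {}" and mu_pos: "\<mu> > 0"
begin

abbreviation step where "step \<equiv> glauber_step G \<mu>"
abbreviation law where "law \<equiv> glauber_law G \<mu>"

lemma wt_gt0: "wt G \<mu> \<sigma> > 0"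
  by (rule wt_pos[OF mu_pos])

lemma Z_gt0: "partition_function G \<mu> > 0"
  by (rule partition_function_pos[OF finite_verts mu_pos])

lemma fin_configs: "finite (configs G)"
  by (rule finite_configs[OF finite_verts])

definition accept where
  "accept \<sigma> v = wt G \<mu> (flip \<sigma> v) / (wt G \<mu> \<sigma> + wt G \<mu> (flip \<sigma> v))"

lemma accept_bounds: "0 < accept \<sigma> v" "accept \<sigma> v < 1"
  using wt_gt0[of \<sigma>] wt_gt0[of "flip \<sigma> v"] by (auto simp: accept_def field_simps)

text \<open>A proposal at \<open>v\<close> either moves to \<open>flip \<sigma> v\<close> or is
  rejected, so every vertex also contributes to the holding probability of
  \<open>\<sigma>\<close>.\<close>

lemma pmf_step:
  "pmf (step \<sigma>) \<tau> =
     (\<Sum>v\<in>verts G. accept \<sigma> v * of_bool (flip \<sigma> v = \<tau>) + (1 - accept \<sigma> v) * of_bool (\<sigma> = \<tau>))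
       / card (verts G)"
proof -
  have "pmf (bernoulli_pmf (accept \<sigma> v) \<bind> (\<lambda>acc. return_pmf (if acc then flip \<sigma> v else \<sigma>))) \<tau> =
     accept \<sigma> v * of_bool (flip \<sigma> v = \<tau>) + (1 - accept \<sigma> v) * of_bool (\<sigma> = \<tau>)" for v
    using accept_bounds[of \<sigma> v] by (simp add: pmf_bind indicator_def)
  then show ?thesis
    unfolding glauber_step_def accept_def[symmetric]
    by (subst pmf_bind) (simp add: integral_pmf_of_set finite_verts verts_nonempty)
qed

lemma set_pmf_step: "\<sigma> \<in> configs G \<Longrightarrow> set_pmf (step \<sigma>) \<subseteq> configs G"
  using finite_verts verts_nonempty
  by (auto simp: glauber_step_def flip_in_configs split: if_splits)

lemma law_0 [simp]: "law \<omega> 0 = return_pmf \<omega>"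
  by (simp add: glauber_law_def)

lemma law_Suc: "law \<omega> (Suc t) = bind_pmf (law \<omega> t) step"
  by (simp add: glauber_law_def)

lemma set_pmf_law: "\<omega> \<in> configs G \<Longrightarrow> set_pmf (law \<omega> t) \<subseteq> configs G"
proof (induction t)
  case (Suc t)
  then show ?case using set_pmf_step by (fastforce simp: law_Suc)
qed auto

text \<open>Chapman-Kolmogorov. Induction on \<open>m\<close> fits because \<open>law_Suc\<close>
  appends its step at the end.\<close>

lemma law_add: "law \<omega> (t + m) = bind_pmf (law \<omega> t) (\<lambda>\<sigma>. law \<sigma> m)"
  by (induction m) (simp_all add: law_Suc bind_return_pmf' bind_assoc_pmf)

lemma pmf_bind_configs:
  assumes "set_pmf p \<subseteq> configs G"
  shows "pmf (bind_pmf p f) \<tau> = (\<Sum>\<sigma>\<in>configs G. pmf p \<sigma> * pmf (f \<sigma>) \<tau>)"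
  unfolding pmf_bind
  by (subst integral_measure_pmf_real[OF fin_configs]) (use assms in \<open>auto simp: mult.commute\<close>)

lemma set_pmf_gibbs: "set_pmf (gibbs G \<mu>) \<subseteq> configs G"
  by (auto simp: set_pmf_iff pmf_gibbs[OF finite_verts mu_pos] split: if_splits)

lemma sum_pmf_configs: "set_pmf p \<subseteq> configs G \<Longrightarrow> (\<Sum>\<sigma>\<in>configs G. pmf p \<sigma>) = 1"
  by (rule sum_pmf_eq_1[OF fin_configs])

section \<open>Reversibility and stationarity of the Gibbs distribution\<close>

lemma flip_flip: "flip (flip \<sigma> v) v = \<sigma>"
  by (auto simp: flip_def)

text \<open>For each vertex leading from \<open>\<sigma>\<close> to \<open>\<tau>\<close> the flow
  is \<open>wt \<sigma>\<close> times \<open>wt \<tau>\<close> over their sum, which is symmetric;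
  the same vertex leads back.\<close>

lemma detailed_balance: "wt G \<mu> \<sigma> * pmf (step \<sigma>) \<tau> = wt G \<mu> \<tau> * pmf (step \<tau>) \<sigma>"
proof (cases "\<sigma> = \<tau>")
  case False
  have "wt G \<mu> \<sigma> * (accept \<sigma> v * of_bool (flip \<sigma> v = \<tau>)) =
        wt G \<mu> \<tau> * (accept \<tau> v * of_bool (flip \<tau> v = \<sigma>))" for v
    using flip_flip[of \<sigma> v] flip_flip[of \<tau> v] by (auto simp: accept_def add.commute)
  then show ?thesis
    using False by (simp add: pmf_step sum_distrib_left)
qed simp

text \<open>Reversing each term by detailed balance turns the sum over predecessors of
  \<open>\<tau>\<close> into \<open>wt \<tau>\<close> times a row sum, which is 1. Outside
  \<open>configs G\<close> both sides vanish.\<close>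

lemma gibbs_stationary_step: "bind_pmf (gibbs G \<mu>) step = gibbs G \<mu>"
proof (rule pmf_eqI)
  fix \<tau>
  show "pmf (bind_pmf (gibbs G \<mu>) step) \<tau> = pmf (gibbs G \<mu>) \<tau>"
  proof (cases "\<tau> \<in> configs G")
    case True
    have "pmf (bind_pmf (gibbs G \<mu>) step) \<tau> =
        (\<Sum>\<sigma>\<in>configs G. wt G \<mu> \<sigma> * pmf (step \<sigma>) \<tau>) / partition_function G \<mu>"
      by (simp add: pmf_bind_configs[OF set_pmf_gibbs] pmf_gibbs[OF finite_verts mu_pos] sum_divide_distrib)
    also have "(\<Sum>\<sigma>\<in>configs G. wt G \<mu> \<sigma> * pmf (step \<sigma>) \<tau>) = wt G \<mu> \<tau>"
      by (subst detailed_balance)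
        (simp add: sum_distrib_left[symmetric] sum_pmf_configs[OF set_pmf_step[OF True]])
    finally show ?thesis using True by (simp add: pmf_gibbs[OF finite_verts mu_pos])
  next
    case False
    have "set_pmf (bind_pmf (gibbs G \<mu>) step) \<subseteq> configs G"
      using set_pmf_gibbs set_pmf_step by fastforce
    then show ?thesis using False set_pmf_gibbs by (metis pmf_eq_0_set_pmf subsetD)
  qed
qed

lemma gibbs_stationary: "bind_pmf (gibbs G \<mu>) (\<lambda>\<sigma>. law \<sigma> t) = gibbs G \<mu>"
proof (induction t)
  case (Suc t)
  have "bind_pmf (gibbs G \<mu>) (\<lambda>\<sigma>. law \<sigma> (Suc t)) = bind_pmf (bind_pmf (gibbs G \<mu>) (\<lambda>\<sigma>. law \<sigma> t)) step"
    by (simp add: law_Suc bind_assoc_pmf)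
  then show ?case by (simp add: Suc gibbs_stationary_step)
qed (simp add: bind_return_pmf')

section \<open>Convergence to the Gibbs distribution\<close>

lemma pmf_step_flip_pos: "v \<in> verts G \<Longrightarrow> pmf (step \<sigma>) (flip \<sigma> v) > 0"
  unfolding pmf_step
  by (intro divide_pos_pos sum_pos2[of _ v])
    (use finite_verts verts_nonempty accept_bounds[of \<sigma>]
      in \<open>auto simp: less_imp_le add_pos_nonneg card_gt_0_iff intro!: add_nonneg_nonneg mult_nonneg_nonneg\<close>)

lemma pmf_step_self_pos: "pmf (step \<sigma>) \<sigma> > 0"
  unfolding pmf_step
  by (intro divide_pos_pos sum_pos)
    (use finite_verts verts_nonempty accept_bounds[of \<sigma>]
      in \<open>auto simp: less_imp_le add_nonneg_pos card_gt_0_iff\<close>)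

lemma pmf_law_Suc_pos:
  assumes "pmf (law \<sigma> m) \<rho> > 0" "pmf (step \<rho>) \<tau> > 0"
  shows "pmf (law \<sigma> (Suc m)) \<tau> > 0"
proof -
  have "\<rho> \<in> set_pmf (law \<sigma> m)" "\<tau> \<in> set_pmf (step \<rho>)"
    using assms by (auto simp: set_pmf_iff)
  then have "\<tau> \<in> set_pmf (law \<sigma> (Suc m))" by (auto simp: law_Suc)
  then show ?thesis by (simp add: pmf_positive)
qed

text \<open>The last step either stands still, when at most \<open>m\<close> disagreements are left
  anyway, or repairs one of them. Allowing fewer than \<open>m\<close> disagreements makes a single
  time serve all pairs of configurations.\<close>

lemma pmf_law_pos:
  assumes "\<sigma> \<in> configs G" "\<tau> \<in> configs G" "card {v\<in>verts G. \<sigma> v \<noteq> \<tau> v} \<le> m"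
  shows "pmf (law \<sigma> m) \<tau> > 0"
  using assms(2,3)
proof (induction m arbitrary: \<tau>)
  case 0
  then have "\<sigma> v = \<tau> v" if "v \<in> verts G" for v using finite_verts that by auto
  then have "\<sigma> = \<tau>"
    using assms(1) 0(1) unfolding configs_def by (intro PiE_ext[of \<sigma> _ _ \<tau>]) auto
  then show ?case by simp
next
  case (Suc m)
  show ?case
  proof (cases "card {v\<in>verts G. \<sigma> v \<noteq> \<tau> v} \<le> m")
    case True
    then show ?thesis
      using pmf_law_Suc_pos[OF Suc.IH pmf_step_self_pos] Suc.prems by blast
  next
    case False
    then have "{v\<in>verts G. \<sigma> v \<noteq> \<tau> v} \<noteq> {}" by (metis card.empty le0)
    then obtain v where v: "v \<in> verts G" "\<sigma> v \<noteq> \<tau> v" by blast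
    have "{w\<in>verts G. \<sigma> w \<noteq> flip \<tau> v w} = {v\<in>verts G. \<sigma> v \<noteq> \<tau> v} - {v}"
      using v by (auto simp: flip_def)
    then have "card {w\<in>verts G. \<sigma> w \<noteq> flip \<tau> v w} \<le> m"
      using v Suc.prems(2) finite_verts by simp
    then have "pmf (law \<sigma> m) (flip \<tau> v) > 0"
      using Suc.IH flip_in_configs[OF Suc.prems(1) v(1)] by blast
    moreover have "pmf (step (flip \<tau> v)) \<tau> > 0"
      using pmf_step_flip_pos[OF v(1), of "flip \<tau> v"] by (simp add: flip_flip)
    ultimately show ?thesis by (rule pmf_law_Suc_pos)
  qed
qed

lemma prob_configs:
  assumes "set_pmf p \<subseteq> configs G"
  shows "measure_pmf.prob p A = (\<Sum>\<sigma>\<in>A \<inter> configs G. pmf p \<sigma>)"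
proof -
  have "measure_pmf.prob p A = measure_pmf.prob p (A \<inter> configs G)"
    by (rule measure_eq_AE) (use assms in \<open>auto simp: AE_measure_pmf_iff\<close>)
  then show ?thesis
    using fin_configs by (simp add: measure_measure_pmf_finite)
qed

lemma tv_dist_le_l1:
  assumes "set_pmf p \<subseteq> configs G" "set_pmf q \<subseteq> configs G"
  shows "tv_dist p q \<le> (\<Sum>\<sigma>\<in>configs G. \<bar>pmf p \<sigma> - pmf q \<sigma>\<bar>)"
  unfolding tv_dist_def
proof (rule cSUP_least)
  fix A :: "('a \<Rightarrow> bool) set"
  have "\<bar>measure_pmf.prob p A - measure_pmf.prob q A\<bar> = \<bar>\<Sum>\<sigma>\<in>A \<inter> configs G. pmf p \<sigma> - pmf q \<sigma>\<bar>"
    using assms by (simp add: prob_configs sum_subtractf)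
  also have "\<dots> \<le> (\<Sum>\<sigma>\<in>A \<inter> configs G. \<bar>pmf p \<sigma> - pmf q \<sigma>\<bar>)"
    by (rule sum_abs)
  also have "\<dots> \<le> (\<Sum>\<sigma>\<in>configs G. \<bar>pmf p \<sigma> - pmf q \<sigma>\<bar>)"
    by (rule sum_mono2) (auto simp: fin_configs)
  finally show "\<bar>measure_pmf.prob p A - measure_pmf.prob q A\<bar> \<le> \<dots>" .
qed simp

text \<open>Doeblin minorization: the common part \<open>\<epsilon>\<close> of all rows acts equally
  on \<open>p\<close> and \<open>q\<close> and cancels, and what is left of each row has mass
  \<open>1 - \<epsilon> * card (configs G)\<close>.\<close>

lemma l1_contraction:
  assumes p: "set_pmf p \<subseteq> configs G" and q: "set_pmf q \<subseteq> configs G"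
    and \<epsilon>: "\<And>\<sigma> \<tau>. \<sigma> \<in> configs G \<Longrightarrow> \<tau> \<in> configs G \<Longrightarrow> \<epsilon> \<le> pmf (law \<sigma> m) \<tau>"
  shows "(\<Sum>\<tau>\<in>configs G. \<bar>pmf (bind_pmf p (\<lambda>\<sigma>. law \<sigma> m)) \<tau> - pmf (bind_pmf q (\<lambda>\<sigma>. law \<sigma> m)) \<tau>\<bar>)
    \<le> (1 - \<epsilon> * card (configs G)) * (\<Sum>\<sigma>\<in>configs G. \<bar>pmf p \<sigma> - pmf q \<sigma>\<bar>)"
proof -
  let ?C = "configs G" and ?d = "\<lambda>\<sigma>. pmf p \<sigma> - pmf q \<sigma>"
  have d0: "(\<Sum>\<sigma>\<in>?C. ?d \<sigma>) = 0"
    by (simp add: sum_subtractf sum_pmf_configs p q)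
  have "\<bar>pmf (bind_pmf p (\<lambda>\<sigma>. law \<sigma> m)) \<tau> - pmf (bind_pmf q (\<lambda>\<sigma>. law \<sigma> m)) \<tau>\<bar>
      \<le> (\<Sum>\<sigma>\<in>?C. \<bar>?d \<sigma>\<bar> * (pmf (law \<sigma> m) \<tau> - \<epsilon>))" if "\<tau> \<in> ?C" for \<tau>
  proof -
    have "pmf (bind_pmf p (\<lambda>\<sigma>. law \<sigma> m)) \<tau> - pmf (bind_pmf q (\<lambda>\<sigma>. law \<sigma> m)) \<tau>
        = (\<Sum>\<sigma>\<in>?C. ?d \<sigma> * pmf (law \<sigma> m) \<tau>)"
      by (simp add: pmf_bind_configs p q sum_subtractf left_diff_distrib)
    \<comment> \<open>Subtracting the constant \<open>\<epsilon>\<close> is free because the signed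
      differences have total mass 0.\<close>
    also have "\<dots> = (\<Sum>\<sigma>\<in>?C. ?d \<sigma> * (pmf (law \<sigma> m) \<tau> - \<epsilon>))"
      using d0 by (simp add: right_diff_distrib sum_subtractf sum_distrib_right[symmetric])
    also have "\<bar>\<dots>\<bar> \<le> (\<Sum>\<sigma>\<in>?C. \<bar>?d \<sigma> * (pmf (law \<sigma> m) \<tau> - \<epsilon>)\<bar>)"
      by (rule sum_abs)
    also have "\<dots> = (\<Sum>\<sigma>\<in>?C. \<bar>?d \<sigma>\<bar> * (pmf (law \<sigma> m) \<tau> - \<epsilon>))"
      using \<epsilon>[OF _ that] by (intro sum.cong) (auto simp: abs_mult)
    finally show ?thesis .
  qed
  then have "(\<Sum>\<tau>\<in>?C. \<bar>pmf (bind_pmf p (\<lambda>\<sigma>. law \<sigma> m)) \<tau> - pmf (bind_pmf q (\<lambda>\<sigma>. law \<sigma> m)) \<tau>\<bar>)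
      \<le> (\<Sum>\<tau>\<in>?C. \<Sum>\<sigma>\<in>?C. \<bar>?d \<sigma>\<bar> * (pmf (law \<sigma> m) \<tau> - \<epsilon>))"
    by (rule sum_mono)
  also have "\<dots> = (\<Sum>\<sigma>\<in>?C. \<bar>?d \<sigma>\<bar> * (\<Sum>\<tau>\<in>?C. pmf (law \<sigma> m) \<tau> - \<epsilon>))"
    by (subst sum.swap) (simp add: sum_distrib_left)
  also have "\<dots> = (\<Sum>\<sigma>\<in>?C. \<bar>?d \<sigma>\<bar> * (1 - \<epsilon> * card ?C))"
    by (intro sum.cong) (auto simp: sum_subtractf sum_pmf_configs set_pmf_law)
  finally show ?thesis by (simp add: sum_distrib_left mult.commute)
qed

text \<open>Guarantees that the \<open>LEAST\<close> in \<open>mixing_time\<close> is attained. The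
  contraction is iterated along the times \<open>k * m\<close>.\<close>

lemma tv_dist_law_eventually_small:
  assumes "\<omega> \<in> configs G" "\<delta> > 0"
  shows "\<exists>t. tv_dist (law \<omega> t) (gibbs G \<mu>) \<le> \<delta>"
proof -
  let ?C = "configs G"
  \<comment> \<open>Two configurations disagree in at most this many vertices, so at time
    \<open>m\<close> all transition probabilities are positive.\<close>
  define m where "m = card (verts G)"
  define \<epsilon> where "\<epsilon> = Min ((\<lambda>(\<sigma>, \<tau>). pmf (law \<sigma> m) \<tau>) ` (?C \<times> ?C))"
  have "pmf (law \<sigma> m) \<tau> > 0" if "\<sigma> \<in> ?C" "\<tau> \<in> ?C" for \<sigma> \<tau>
    by (rule pmf_law_pos[OF that]) (auto simp: m_def intro: card_mono finite_verts)
  then have \<epsilon>: "\<epsilon> > 0" 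
    unfolding \<epsilon>_def using fin_configs configs_nonempty by (subst Min_gr_iff) auto
  have \<epsilon>_le: "\<epsilon> \<le> pmf (law \<sigma> m) \<tau>" if "\<sigma> \<in> ?C" "\<tau> \<in> ?C" for \<sigma> \<tau>
    unfolding \<epsilon>_def using fin_configs that by (intro Min_le) auto
  define r where "r = 1 - \<epsilon> * card ?C"
  have "card ?C > 0" using fin_configs configs_nonempty by (simp add: card_gt_0_iff)
  then have "r < 1" using \<epsilon> by (simp add: r_def)
  have "\<epsilon> * card ?C = (\<Sum>\<tau>\<in>?C. \<epsilon>)" by simp
  also have "\<dots> \<le> (\<Sum>\<tau>\<in>?C. pmf (law \<omega> m) \<tau>)" using \<epsilon>_le[OF assms(1)] by (rule sum_mono)
  also have "\<dots> = 1" by (rule sum_pmf_configs[OF set_pmf_law[OF assms(1)]])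
  finally have "0 \<le> r" by (simp add: r_def)
  define D where "D t = (\<Sum>\<sigma>\<in>?C. \<bar>pmf (law \<omega> t) \<sigma> - pmf (gibbs G \<mu>) \<sigma>\<bar>)" for t
  have "D (k * m) \<le> r ^ k * D 0" for k
  proof (induction k)
    case (Suc k)
    have "D (Suc k * m) \<le> r * D (k * m)"
      using l1_contraction[OF set_pmf_law[OF assms(1)] set_pmf_gibbs \<epsilon>_le, of "k * m"]
      by (simp add: D_def r_def gibbs_stationary law_add[symmetric] add.commute)
    also have "\<dots> \<le> r * (r ^ k * D 0)" using Suc \<open>0 \<le> r\<close> by (rule mult_left_mono)
    finally show ?case by (simp add: mult.assoc)
  qed simp
  moreover have "(\<lambda>k. r ^ k * D 0) \<longlonglongrightarrow> 0"
    using LIMSEQ_realpow_zero[OF \<open>0 \<le> r\<close> \<open>r < 1\<close>] by (rule tendsto_mult_left_zero)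
  then have "\<forall>\<^sub>F k in sequentially. r ^ k * D 0 < \<delta>"
    using assms(2) by (rule order_tendstoD)
  then obtain k where "r ^ k * D 0 < \<delta>" by (auto simp: eventually_sequentially)
  ultimately have "D (k * m) \<le> \<delta>" by (meson less_imp_le order_trans)
  then show ?thesis
    using tv_dist_le_l1[OF set_pmf_law[OF assms(1)] set_pmf_gibbs] unfolding D_def by (meson order_trans)
qed

section \<open>Escape through a bottleneck\<close>

lemma pmf_gibbs_configs: "\<sigma> \<in> configs G \<Longrightarrow> pmf (gibbs G \<mu>) \<sigma> = wt G \<mu> \<sigma> / partition_function G \<mu>"
  by (simp add: pmf_gibbs[OF finite_verts mu_pos])

text \<open>The left side is, up to the factor \<open>partition_function G \<mu>\<close>, a single
  term of the stationarity equation at \<open>\<tau>\<close>.\<close>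

lemma wt_law_le:
  assumes "\<omega> \<in> configs G" "\<tau> \<in> configs G"
  shows "wt G \<mu> \<omega> * pmf (law \<omega> t) \<tau> \<le> wt G \<mu> \<tau>"
proof -
  have "pmf (gibbs G \<mu>) \<omega> * pmf (law \<omega> t) \<tau> \<le> (\<Sum>\<sigma>\<in>configs G. pmf (gibbs G \<mu>) \<sigma> * pmf (law \<sigma> t) \<tau>)"
    using assms(1) fin_configs by (intro member_le_sum) auto
  also have "\<dots> = pmf (gibbs G \<mu>) \<tau>"
    by (simp add: pmf_bind_configs[OF set_pmf_gibbs, symmetric] gibbs_stationary)
  finally show ?thesis
    using Z_gt0 assms by (simp add: pmf_gibbs_configs field_simps)
qed

text \<open>Leaving \<open>A\<close> requires a visit to \<open>B\<close>, and by stationarity the visit at any fixed time has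
  probability at most \<open>wt B / wt \<omega>\<close>.\<close>

lemma escape_bound:
  assumes \<omega>: "\<omega> \<in> configs G" "\<omega> \<in> A" and "A \<subseteq> configs G" "B \<subseteq> A"
    and exit: "\<And>\<sigma> v. \<sigma> \<in> A \<Longrightarrow> v \<in> verts G \<Longrightarrow> flip \<sigma> v \<notin> A \<Longrightarrow> \<sigma> \<in> B"
  shows "wt G \<mu> \<omega> * measure_pmf.prob (law \<omega> t) (- A) \<le> t * (\<Sum>\<sigma>\<in>B. wt G \<mu> \<sigma>)"
proof (induction t)
  case 0
  then show ?case using \<omega> by (simp add: measure_return)
next
  case (Suc t)
  let ?C = "configs G"
  define k where "k \<sigma> = measure_pmf.prob (step \<sigma>) (- A)" for \<sigma>
  have [simp]: "finite A" "finite B"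
    using assms fin_configs finite_subset by metis+
  have BC: "B \<subseteq> ?C" using assms by blast
  have k0: "k \<sigma> = 0" if "\<sigma> \<in> A" "\<sigma> \<notin> B" for \<sigma>
  proof -
    have "set_pmf (step \<sigma>) \<subseteq> A"
      using that exit finite_verts verts_nonempty by (auto simp: glauber_step_def split: if_splits)
    then show ?thesis unfolding k_def by (auto simp: measure_pmf_zero_iff)
  qed
  have k: "0 \<le> k \<sigma>" "k \<sigma> \<le> 1" for \<sigma> by (auto simp: k_def)
  have "measure_pmf.prob (law \<omega> (Suc t)) (- A) = (\<Sum>\<sigma>\<in>?C. pmf (law \<omega> t) \<sigma> * k \<sigma>)"
  proof -
    have "measure_pmf.prob (law \<omega> (Suc t)) (- A) = (\<Sum>\<tau>\<in>- A \<inter> ?C. \<Sum>\<sigma>\<in>?C. pmf (law \<omega> t) \<sigma> * pmf (step \<sigma>) \<tau>)"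
      by (simp only: prob_configs[OF set_pmf_law[OF \<omega>(1)]])
        (simp add: law_Suc pmf_bind_configs set_pmf_law \<omega>(1))
    also have "\<dots> = (\<Sum>\<sigma>\<in>?C. pmf (law \<omega> t) \<sigma> * (\<Sum>\<tau>\<in>- A \<inter> ?C. pmf (step \<sigma>) \<tau>))"
      by (subst sum.swap) (simp add: sum_distrib_left)
    also have "\<dots> = (\<Sum>\<sigma>\<in>?C. pmf (law \<omega> t) \<sigma> * k \<sigma>)"
      unfolding k_def by (intro sum.cong refl arg_cong2[of _ _ _ _ "(*)"] prob_configs[symmetric] set_pmf_step)
    finally show ?thesis .
  qed
  \<comment> \<open>Mass already outside \<open>A\<close> is counted in full, even if it returns;
    mass inside \<open>A\<close> can leave only from \<open>B\<close>.\<close>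
  also have "\<dots> \<le> (\<Sum>\<sigma>\<in>?C. pmf (law \<omega> t) \<sigma> * (of_bool (\<sigma> \<notin> A) + of_bool (\<sigma> \<in> B)))"
    by (intro sum_mono mult_left_mono) (use k k0 \<open>B \<subseteq> A\<close> in \<open>auto simp: of_bool_def\<close>)
  also have "\<dots> = (\<Sum>\<sigma>\<in>- A \<inter> ?C. pmf (law \<omega> t) \<sigma>) + (\<Sum>\<sigma>\<in>B \<inter> ?C. pmf (law \<omega> t) \<sigma>)"
    using fin_configs
    by (simp add: distrib_left sum.distrib sum_mult_of_bool_eq Compl_eq Int_commute del: of_bool_not_iff)
  also have "(\<Sum>\<sigma>\<in>- A \<inter> ?C. pmf (law \<omega> t) \<sigma>) = measure_pmf.prob (law \<omega> t) (- A)"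
    by (rule prob_configs[OF set_pmf_law[OF \<omega>(1)], symmetric])
  also have "B \<inter> ?C = B" using BC by blast
  finally have "wt G \<mu> \<omega> * measure_pmf.prob (law \<omega> (Suc t)) (- A) \<le>
      wt G \<mu> \<omega> * measure_pmf.prob (law \<omega> t) (- A) + (\<Sum>\<sigma>\<in>B. wt G \<mu> \<omega> * pmf (law \<omega> t) \<sigma>)"
    using wt_gt0[of \<omega>] by (simp add: sum_distrib_left[symmetric] distrib_left[symmetric])
  also have "\<dots> \<le> t * (\<Sum>\<sigma>\<in>B. wt G \<mu> \<sigma>) + (\<Sum>\<sigma>\<in>B. wt G \<mu> \<sigma>)"
    using Suc BC by (intro add_mono sum_mono wt_law_le \<omega>(1)) auto
  finally show ?case by (simp add: algebra_simps)
qed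

lemma tv_dist_ge: "\<bar>measure_pmf.prob p A - measure_pmf.prob q A\<bar> \<le> tv_dist p q"
  unfolding tv_dist_def
proof (rule cSUP_upper[OF UNIV_I], rule bdd_aboveI2)
  show "\<bar>measure_pmf.prob p A - measure_pmf.prob q A\<bar> \<le> 1" for A
    using measure_pmf.prob_le_1[of p A] measure_pmf.prob_le_1[of q A]
      measure_nonneg[of p A] measure_nonneg[of q A] by linarith
qed

text \<open>The complement of \<open>A\<close> has Gibbs probability at least 1/2, so a chain within
  distance 1/4 of it has left \<open>A\<close> with probability at least 1/4. The escape bound then
  forces the time to be large.\<close>

theorem mixing_time_bottleneck:
  assumes \<omega>: "\<omega> \<in> A" and A: "A \<subseteq> configs G" and B: "B \<subseteq> A"
    and exit: "\<And>\<sigma> v. \<sigma> \<in> A \<Longrightarrow> v \<in> verts G \<Longrightarrow> flip \<sigma> v \<notin> A \<Longrightarrow> \<sigma> \<in> B"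
    and half: "2 * (\<Sum>\<sigma>\<in>A. wt G \<mu> \<sigma>) \<le> partition_function G \<mu>"
  shows "wt G \<mu> \<omega> \<le> 4 * real (mixing_time G \<mu>) * (\<Sum>\<sigma>\<in>B. wt G \<mu> \<sigma>)"
proof -
  have \<omega>C: "\<omega> \<in> configs G" using \<omega> A by blast
  define t where "t = (LEAST t. tv_dist (law \<omega> t) (gibbs G \<mu>) \<le> 1 / 4)"
  have "tv_dist (law \<omega> t) (gibbs G \<mu>) \<le> 1 / 4"
    unfolding t_def by (rule LeastI_ex) (rule tv_dist_law_eventually_small[OF \<omega>C], simp)
  then have "measure_pmf.prob (gibbs G \<mu>) (- A) - measure_pmf.prob (law \<omega> t) (- A) \<le> 1 / 4"
    using tv_dist_ge[of "law \<omega> t" "- A" "gibbs G \<mu>"] by linarith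
  moreover have "measure_pmf.prob (gibbs G \<mu>) A = (\<Sum>\<sigma>\<in>A. wt G \<mu> \<sigma>) / partition_function G \<mu>"
    using A unfolding prob_configs[OF set_pmf_gibbs] sum_divide_distrib
    by (intro sum.cong) (auto simp: pmf_gibbs_configs)
  then have "measure_pmf.prob (gibbs G \<mu>) A \<le> 1 / 2"
    using half Z_gt0 by (simp add: pos_divide_le_eq)
  then have "measure_pmf.prob (gibbs G \<mu>) (- A) \<ge> 1 / 2"
    using measure_pmf.prob_compl[of A "gibbs G \<mu>"] by (simp add: Compl_eq_Diff_UNIV)
  ultimately have "1 / 4 \<le> measure_pmf.prob (law \<omega> t) (- A)" by linarith
  then have "wt G \<mu> \<omega> \<le> 4 * (wt G \<mu> \<omega> * measure_pmf.prob (law \<omega> t) (- A))"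
    using wt_gt0[of \<omega>] by simp
  also have "\<dots> \<le> 4 * (t * (\<Sum>\<sigma>\<in>B. wt G \<mu> \<sigma>))"
    using escape_bound[OF \<omega>C \<omega> A B exit] by simp
  also have "\<dots> \<le> 4 * (real (mixing_time G \<mu>) * (\<Sum>\<sigma>\<in>B. wt G \<mu> \<sigma>))"
  proof -
    have "t \<le> mixing_time G \<mu>"
      unfolding t_def mixing_time_def using fin_configs \<omega>C by (intro Max_ge) auto
    then show ?thesis
      by (intro mult_left_mono mult_right_mono sum_nonneg) (auto simp: wt_gt0 less_imp_le)
  qed
  finally show ?thesis by (simp add: mult.assoc)
qed

end

section \<open>Symmetry under the global spin flip\<close>

lemma cut_cong_on_verts:
  assumes "simple_graph G" "\<And>u v. u \<in> verts G \<Longrightarrow> v \<in> verts G \<Longrightarrow> \<sigma> u = \<sigma> v \<longleftrightarrow> \<tau> u = \<tau> v"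
  shows "cut G \<sigma> = cut G \<tau>"
proof -
  have "u \<in> verts G \<and> v \<in> verts G" if "{u, v} \<in> edges G" for u v
    using that assms(1) unfolding simple_graph_def by (fastforce simp: doubleton_eq_iff)
  then show ?thesis
    unfolding cut_def using assms(2) by blast
qed

lemma inj_on_flip_all: "inj_on (\<lambda>\<sigma>. restrict (\<lambda>v. \<not> \<sigma> v) (verts G)) (configs G)"
proof (rule inj_onI)
  fix \<sigma> \<tau> assume *: "\<sigma> \<in> configs G" "\<tau> \<in> configs G"
    "restrict (\<lambda>v. \<not> \<sigma> v) (verts G) = restrict (\<lambda>v. \<not> \<tau> v) (verts G)"
  have "\<sigma> v = \<tau> v" if "v \<in> verts G" for v
    using fun_cong[OF *(3), of v] that by simp
  then show "\<sigma> = \<tau>"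
    using *(1,2) unfolding configs_def by (intro PiE_ext[of \<sigma> _ _ \<tau>]) auto
qed

text \<open>Flipping all spins preserves the cut and is injective, so \<open>A\<close> and its image
  are disjoint sets of equal weight. The \<open>restrict\<close> keeps the flipped configuration
  extensional.\<close>

lemma (in ising) half_by_symmetry:
  assumes "simple_graph G" "A \<subseteq> configs G"
    and "\<And>\<sigma>. \<sigma> \<in> A \<Longrightarrow> restrict (\<lambda>v. \<not> \<sigma> v) (verts G) \<notin> A"
  shows "2 * (\<Sum>\<sigma>\<in>A. wt G \<mu> \<sigma>) \<le> partition_function G \<mu>"
proof -
  let ?n = "\<lambda>\<sigma>. restrict (\<lambda>v. \<not> \<sigma> v) (verts G)"
  have finA: "finite A" using assms(2) fin_configs by (rule finite_subset)
  have "cut G (?n \<sigma>) = cut G \<sigma>" for \<sigma>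
    by (rule cut_cong_on_verts[OF assms(1)]) simp
  then have "(\<Sum>\<sigma>\<in>?n ` A. wt G \<mu> \<sigma>) = (\<Sum>\<sigma>\<in>A. wt G \<mu> \<sigma>)"
    by (simp add: sum.reindex inj_on_subset[OF inj_on_flip_all assms(2)] wt_def)
  then have "2 * (\<Sum>\<sigma>\<in>A. wt G \<mu> \<sigma>) = (\<Sum>\<sigma>\<in>A \<union> ?n ` A. wt G \<mu> \<sigma>)"
    using assms(3) finA by (subst sum.union_disjoint) auto
  also have "\<dots> \<le> partition_function G \<mu>"
    unfolding partition_function_def
    by (rule sum_mono2) (use assms(2) fin_configs wt_gt0 in \<open>auto simp: less_imp_le configs_def\<close>)
  finally show ?thesis .
qed

section \<open>Networks of copying gadgets\<close>

text \<open>Listing each edge with its smaller end first makes the map from pairs to edges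
  injective, so cuts can be counted on pairs.\<close>

lemma card_cut_ordered_pairs:
  assumes "edges G = (\<lambda>(u, v). {u, v}) ` P" "\<And>u v. (u, v) \<in> P \<Longrightarrow> u < v"
  shows "card (cut G \<sigma>) = card {(u, v) \<in> P. \<sigma> u \<noteq> \<sigma> (v :: 'a :: linorder)}"
proof -
  let ?f = "\<lambda>(u :: 'a, v). {u, v}"
  have "cut G \<sigma> = ?f ` {(u, v) \<in> P. \<sigma> u \<noteq> \<sigma> v}"
    unfolding cut_def assms(1) by (auto simp: doubleton_eq_iff image_iff) blast+
  moreover have "inj_on ?f P"
    by (intro inj_onI) (auto simp: doubleton_eq_iff dest!: assms(2))
  then have "inj_on ?f {(u, v) \<in> P. \<sigma> u \<noteq> \<sigma> v}" by (rule inj_on_subset) auto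
  ultimately show ?thesis by (simp add: card_image)
qed

text \<open>The shared edge is \<open>{0, 1}\<close>, and the ports are \<open>2, 3, 4\<close>.\<close>

definition gadget_pairs :: "(nat \<times> nat) set" where
  "gadget_pairs = {(0, 1), (0, 2), (0, 3), (0, 4), (1, 2), (1, 3), (1, 4), (3, 4)}"

lemma finite_gadget_pairs [simp]: "finite gadget_pairs"
  by (simp add: gadget_pairs_def)

definition gadget_cut :: "(nat \<Rightarrow> bool) \<Rightarrow> nat" where
  "gadget_cut \<tau> = card {(a, b) \<in> gadget_pairs. \<tau> a \<noteq> \<tau> b}"

lemma gadget_cut_eq: "gadget_cut \<tau> = (\<Sum>(a, b)\<in>gadget_pairs. of_bool (\<tau> a \<noteq> \<tau> b))"
  by (simp add: gadget_cut_def case_prod_unfold sum_of_bool_eq Collect_conj_eq)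

text \<open>If 0 and 1 differ, the cut contains their edge, one edge from each port to them and
  perhaps \<open>{3, 4}\<close>: at most 5. If they agree, each port contributes 0 or 2 to them, and
  unequal ports leave at most 5 in all. The proof checks the 32 patterns.\<close>

lemma gadget_cut_le: "gadget_cut \<tau> + of_bool (\<not> (\<tau> 3 = \<tau> 2 \<and> \<tau> 4 = \<tau> 2)) \<le> 6"
  by (cases "\<tau> 0"; cases "\<tau> 1"; cases "\<tau> 2"; cases "\<tau> 3"; cases "\<tau> 4")
    (simp_all add: gadget_cut_eq gadget_pairs_def)

text \<open>Here \<open>s\<close> is the common spin of the ports. The shared edge has the opposite
  spin, so exactly the six edges between it and the ports are cut.\<close>

lemma gadget_cut_ground:
  assumes "\<And>a. a < 5 \<Longrightarrow> \<tau> a = ((a < 2) \<noteq> s)"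
  shows "gadget_cut \<tau> = 6"
  using assms[of 0] assms[of 1] assms[of 2] assms[of 3] assms[of 4]
  by (cases s) (simp_all add: gadget_cut_eq gadget_pairs_def)

text \<open>Gadget \<open>u\<close> occupies the vertices from \<open>5 * u\<close> to
  \<open>5 * u + 4\<close>. Vertices from \<open>5 * U\<close> on are padding, so that the number of
  vertices can be prescribed exactly.\<close>

definition network :: "nat \<Rightarrow> nat \<Rightarrow> (nat \<times> nat) set \<Rightarrow> nat ugraph" where
  "network V U M = \<lparr>verts = {..<V}, edges = (\<lambda>(u, v). {u, v}) `
     ((\<lambda>(u, a, b). (5 * u + a, 5 * u + b)) ` ({..<U} \<times> gadget_pairs) \<union> M)\<rparr>"

text \<open>The links form a matching on the ports. Their orientation prevents double counting and
  keeps them apart from gadget edges; the matching property leaves each port at most one neighbour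
  outside its gadget.\<close>

locale linked_gadgets =
  fixes V U :: nat and M :: "(nat \<times> nat) set"
  assumes size: "5 * U \<le> V"
    and link_less: "(p, q) \<in> M \<Longrightarrow> p div 5 < q div 5"
    and link_bound: "(p, q) \<in> M \<Longrightarrow> q div 5 < U"
    and link_port: "(p, q) \<in> M \<Longrightarrow> 2 \<le> p mod 5 \<and> 2 \<le> q mod 5"
    and link_unique: "(v, w) \<in> M \<or> (w, v) \<in> M \<Longrightarrow> (v, w') \<in> M \<or> (w', v) \<in> M \<Longrightarrow> w = w'"
begin

abbreviation G where "G \<equiv> network V U M"

lemma verts_network [simp]: "verts G = {..<V}"
  by (simp add: network_def)

section \<open>Adjacency, the quasi-line property and degrees\<close>

definition mates where "mates v = {w. (v, w) \<in> M \<or> (w, v) \<in> M}"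

lemma edge_iff:
  "{v, w} \<in> edges G \<longleftrightarrow>
     (v div 5 = w div 5 \<and> v div 5 < U \<and>
        ((v mod 5, w mod 5) \<in> gadget_pairs \<or> (w mod 5, v mod 5) \<in> gadget_pairs))
     \<or> w \<in> mates v"
proof -
  have gp: "a < 5 \<and> b < 5" if "(a, b) \<in> gadget_pairs" for a b
    using that by (auto simp: gadget_pairs_def)
  have img: "(v, w) \<in> (\<lambda>(u, a, b). (5 * u + a, 5 * u + b)) ` ({..<U} \<times> gadget_pairs) \<longleftrightarrow>
      v div 5 = w div 5 \<and> v div 5 < U \<and> (v mod 5, w mod 5) \<in> gadget_pairs" (is "?L \<longleftrightarrow> ?R") for v w :: nat
  proof
    assume ?L
    then show ?R using gp by fastforce
  next
    assume ?R
    then show ?L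
      by (intro image_eqI[of _ _ "(v div 5, v mod 5, w mod 5)"]) (auto, metis mult_div_mod_eq)
  qed
  have "{v, w} \<in> (\<lambda>(u, v). {u, v}) ` P \<longleftrightarrow> (v, w) \<in> P \<or> (w, v) \<in> P" for P
    by (auto simp: doubleton_eq_iff)
  then show ?thesis
    by (simp only: network_def ugraph.select_convs Un_iff img mates_def mem_Collect_eq) auto
qed

lemma link_lt:
  assumes "(p, q) \<in> M"
  shows "p < q" "q < V"
proof -
  show "p < q" using link_less[OF assms] by (metis div_le_mono leD leI)
  show "q < V" using link_bound[OF assms] size by linarith
qed

lemma simple_network: "simple_graph G"
proof -
  have gp: "a < b \<and> b < 5" if "(a, b) \<in> gadget_pairs" for a b
    using that by (auto simp: gadget_pairs_def)
  have "\<exists>v w. e = {v, w} \<and> v \<in> verts G \<and> w \<in> verts G \<and> v \<noteq> w" if "e \<in> edges G" for e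
  proof -
    from that consider (gadget) u a b where "e = {5 * u + a, 5 * u + b}" "u < U" "(a, b) \<in> gadget_pairs"
      | (link) p q where "e = {p, q}" "(p, q) \<in> M"
      by (auto simp: network_def)
    then show ?thesis
    proof cases
      case gadget
      then have "5 * u + b < V" "a < b" using size gp[OF gadget(3)] by linarith+
      then show ?thesis using gadget
        by (intro exI[of _ "5 * u + a"] exI[of _ "5 * u + b"]) auto
    next
      case link
      then show ?thesis using link_lt[OF link(2)]
        by (intro exI[of _ p] exI[of _ q]) auto
    qed
  qed
  then show ?thesis unfolding simple_graph_def by auto
qed

lemma mates_subset_singleton: "\<exists>w. mates v \<subseteq> {w}"
  using link_unique unfolding mates_def by blast

lemma mates_verts: "mates v \<subseteq> {..<V}"
  using link_lt unfolding mates_def by fastforce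

definition gadget_nbrs :: "nat \<Rightarrow> nat set \<Rightarrow> nat set" where
  "gadget_nbrs u A = (\<lambda>a. 5 * u + a) ` A"

lemma clique_gadget:
  assumes "u < U" "A \<subseteq> {0, 1, 3, 4} \<or> A \<subseteq> {0, 1, 2}"
  shows "clique G (gadget_nbrs u A)"
  unfolding clique_def
proof (intro conjI ballI impI)
  show "gadget_nbrs u A \<subseteq> verts G"
    using assms size by (auto simp: gadget_nbrs_def)
  fix v w assume "v \<in> gadget_nbrs u A" "w \<in> gadget_nbrs u A" "v \<noteq> w"
  then obtain a b where ab: "v = 5 * u + a" "w = 5 * u + b" "a \<in> A" "b \<in> A" "a \<noteq> b"
    by (auto simp: gadget_nbrs_def)
  then have "a \<in> {0, 1, 3, 4} \<and> b \<in> {0, 1, 3, 4} \<or> a \<in> {0, 1, 2} \<and> b \<in> {0, 1, 2}"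
    using assms(2) by blast
  then have "a < 5 \<and> b < 5 \<and> ((a, b) \<in> gadget_pairs \<or> (b, a) \<in> gadget_pairs)"
    using \<open>a \<noteq> b\<close> by (elim disjE conjE insertE emptyE) (simp_all add: gadget_pairs_def)
  then show "{v, w} \<in> edges G"
    using ab assms(1) by (simp add: edge_iff)
qed

lemma clique_mates: "clique G (mates v)"
  using mates_subset_singleton[of v] mates_verts[of v] unfolding clique_def verts_network by blast

lemma gadget_nbrs_iff:
  assumes "A \<subseteq> {..<5}"
  shows "w \<in> gadget_nbrs u A \<longleftrightarrow> w div 5 = u \<and> w mod 5 \<in> A"
proof
  assume "w \<in> gadget_nbrs u A"
  then obtain a where a: "a \<in> A" "w = 5 * u + a" by (auto simp: gadget_nbrs_def)
  then have "a < 5" using assms by blast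
  then show "w div 5 = u \<and> w mod 5 \<in> A" using a by simp
next
  assume "w div 5 = u \<and> w mod 5 \<in> A"
  then show "w \<in> gadget_nbrs u A"
    unfolding gadget_nbrs_def by (metis image_eqI mult_div_mod_eq)
qed

lemma neighbours_gadget:
  assumes "v div 5 < U"
  shows "neighbours G v = gadget_nbrs (v div 5) {a. (v mod 5, a) \<in> gadget_pairs \<or> (a, v mod 5) \<in> gadget_pairs} \<union> mates v"
    (is "_ = gadget_nbrs _ ?A \<union> _")
proof (rule set_eqI)
  fix w
  have "a < 5 \<and> b < 5" if "(a, b) \<in> gadget_pairs" for a b
    using that by (auto simp: gadget_pairs_def)
  then have "?A \<subseteq> {..<5}" by blast
  moreover have "w < V" if "w div 5 = v div 5"
    using that assms size by linarith
  moreover have "w < V" if "w \<in> mates v"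
    using that mates_verts by blast
  ultimately show "w \<in> neighbours G v \<longleftrightarrow> w \<in> gadget_nbrs (v div 5) ?A \<union> mates v"
    unfolding neighbours_def Un_iff mem_Collect_eq gadget_nbrs_iff[OF \<open>?A \<subseteq> {..<5}\<close>] edge_iff verts_network lessThan_iff
    using assms by metis
qed

text \<open>\<open>1 - t\<close> is the other end of the shared edge and \<open>7 - t\<close> the
  other one of 3 and 4.\<close>

lemma gadget_nbrs_cases:
  assumes "t < 5"
  obtains "t < 2" "{a. (t, a) \<in> gadget_pairs \<or> (a, t) \<in> gadget_pairs} = {1 - t, 3, 4} \<union> {2}"
  | "t = 2" "{a. (t, a) \<in> gadget_pairs \<or> (a, t) \<in> gadget_pairs} = {0, 1}"
  | "t = 3 \<or> t = 4" "{a. (t, a) \<in> gadget_pairs \<or> (a, t) \<in> gadget_pairs} = {0, 1, 7 - t}"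
proof -
  have "t = 0 \<or> t = 1 \<or> t = 2 \<or> t = 3 \<or> t = 4" using assms by linarith
  then show ?thesis
    using that by (elim disjE) (auto simp: gadget_pairs_def)
qed

text \<open>A vertex of the shared edge sees the rest of its \<open>K\<^sub>4\<close> and port 2. A
  port sees a clique of its gadget and at most one link partner. The two sizes give the degree bound
  4.\<close>

lemma quasi_line_vertex:
  assumes "v < V"
  shows "\<exists>A B. A \<union> B = neighbours G v \<and> A \<inter> B = {} \<and> clique G A \<and> clique G B \<and> card A \<le> 3 \<and> card B \<le> 1"
proof (cases "v div 5 < U")
  \<comment> \<open>A padding vertex is isolated.\<close>
  case False
  then have "neighbours G v = {}"
    unfolding neighbours_def mates_def using link_less link_bound
    by (fastforce simp: edge_iff mates_def)
  then show ?thesis by (intro exI[of _ "{}"]) (auto simp: clique_def)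
next
  case True
  let ?g = "gadget_nbrs (v div 5)"
  have split: ?thesis
    if "neighbours G v = ?g A \<union> B" "A \<subseteq> {0, 1, 3, 4} \<or> A \<subseteq> {0, 1, 2}" "card A \<le> 3"
      "clique G B" "?g A \<inter> B = {}" "card B \<le> 1" for A B
  proof -
    have "card (?g A) = card A"
      unfolding gadget_nbrs_def by (intro card_image) (simp add: inj_on_def)
    then show ?thesis
      using that clique_gadget[OF True that(2)] by (intro exI[of _ "?g A"] exI[of _ B]) simp
  qed
  have mates_port: "mates v = {}" if "v mod 5 < 2"
    using link_port that unfolding mates_def by fastforce
  have card_mates: "card (mates v) \<le> 1"
    using mates_subset_singleton[of v] card_mono[OF finite.insertI[OF finite.emptyI]] by fastforce
  have "w div 5 \<noteq> v div 5" if "w \<in> mates v" for w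
    using that link_less unfolding mates_def by fastforce
  then have disj: "?g A \<inter> mates v = {}" if "A \<subseteq> {..<5}" for A
    using gadget_nbrs_iff[OF that] by blast
  have "v mod 5 < 5" by simp
  then show ?thesis
  proof (cases rule: gadget_nbrs_cases)
    case 1
    show ?thesis
    proof (rule split)
      show "neighbours G v = ?g {1 - v mod 5, 3, 4} \<union> ?g {2}"
        unfolding neighbours_gadget[OF True] 1(2) mates_port[OF 1(1)]
        by (simp only: gadget_nbrs_def image_Un Un_empty_right)
      show "{1 - v mod 5, 3, 4} \<subseteq> {0, 1, 3, 4} \<or> {1 - v mod 5, 3, 4} \<subseteq> {0, 1, 2}" by auto
      show "card {1 - v mod 5, 3, 4} \<le> 3" by (simp add: card_insert_if)
      show "clique G (?g {2})" by (rule clique_gadget[OF True]) simp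
      show "?g {1 - v mod 5, 3, 4} \<inter> ?g {2} = {}" by (auto simp: gadget_nbrs_def)
      show "card (?g {2}) \<le> 1" by (simp add: gadget_nbrs_def)
    qed
  next
    case 2
    show ?thesis
    proof (rule split)
      show "neighbours G v = ?g {0, 1} \<union> mates v"
        unfolding neighbours_gadget[OF True] 2(2) ..
    qed (simp_all add: disj card_mates[simplified] clique_mates)
  next
    case 3
    then have t: "7 - v mod 5 = 3 \<or> 7 - v mod 5 = 4" by linarith
    show ?thesis
    proof (rule split)
      show "neighbours G v = ?g {0, 1, 7 - v mod 5} \<union> mates v"
        unfolding neighbours_gadget[OF True] 3(2) ..
      show "{0, 1, 7 - v mod 5} \<subseteq> {0, 1, 3, 4} \<or> {0, 1, 7 - v mod 5} \<subseteq> {0, 1, 2}"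
        using t by auto
      show "card {0, 1, 7 - v mod 5} \<le> 3" by (simp add: card_insert_if)
      show "?g {0, 1, 7 - v mod 5} \<inter> mates v = {}"
        using t by (intro disj) auto
    qed (rule clique_mates card_mates)+
  qed
qed

lemma quasi_line_network: "quasi_line G"
  using quasi_line_vertex unfolding quasi_line_def by (metis lessThan_iff verts_network)

lemma degree_network:
  assumes "v \<in> verts G"
  shows "vertex_degree G v \<le> 4"
proof -
  obtain A B where "A \<union> B = neighbours G v" "card A \<le> 3" "card B \<le> 1"
    using quasi_line_vertex[of v] assms by auto
  then show ?thesis using card_Un_le[of A B] unfolding vertex_degree_def by simp
qed

section \<open>Cut sizes and defects\<close>

lemma finite_links: "finite M"
  using link_lt by (intro finite_subset[of M "{..<V} \<times> {..<V}"]) fastforce+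

text \<open>Division by 5 recovers the gadget of an edge and shows that links are never gadget
  edges, so the counts add up.\<close>

lemma card_cut_network:
  "card (cut G \<sigma>) = (\<Sum>u<U. gadget_cut (\<lambda>a. \<sigma> (5 * u + a))) + card {(p, q) \<in> M. \<sigma> p \<noteq> \<sigma> q}"
proof -
  let ?f = "\<lambda>(u :: nat, a, b). (5 * u + a, 5 * u + b)"
  let ?P = "?f ` ({..<U} \<times> gadget_pairs)"
  let ?C = "SIGMA u:{..<U}. {(a, b) \<in> gadget_pairs. \<sigma> (5 * u + a) \<noteq> \<sigma> (5 * u + b)}"
  have gp: "a < b \<and> b < 5" if "(a, b) \<in> gadget_pairs" for a b
    using that by (auto simp: gadget_pairs_def)
  have fin: "finite {(a, b). (a, b) \<in> gadget_pairs \<and> Q a b}" for Q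
    by (rule finite_subset[OF _ finite_gadget_pairs]) auto
  have "card (cut G \<sigma>) = card {(u, v) \<in> ?P \<union> M. \<sigma> u \<noteq> \<sigma> v}"
  proof (rule card_cut_ordered_pairs)
    show "edges G = (\<lambda>(u, v). {u, v}) ` (?P \<union> M)" by (simp add: network_def)
    show "u < v" if "(u, v) \<in> ?P \<union> M" for u v
      using that
    proof
      assume "(u, v) \<in> ?P"
      then show "u < v" using gp by auto
    qed (rule link_lt)
  qed
  also have "{(u, v) \<in> ?P \<union> M. \<sigma> u \<noteq> \<sigma> v} = ?f ` ?C \<union> {(p, q) \<in> M. \<sigma> p \<noteq> \<sigma> q}"
    (is "_ = _ \<union> ?L")
  proof (intro equalityI subsetI)
    fix x assume "x \<in> {(u, v) \<in> ?P \<union> M. \<sigma> u \<noteq> \<sigma> v}"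
    then consider "x \<in> ?P" "\<sigma> (fst x) \<noteq> \<sigma> (snd x)" | "x \<in> ?L" by fastforce
    then show "x \<in> ?f ` ?C \<union> ?L"
    proof cases
      case 1
      then obtain u a b where "u < U" "(a, b) \<in> gadget_pairs" "x = (5 * u + a, 5 * u + b)" by auto
      then show ?thesis using 1(2) by (intro UnI1 image_eqI[of _ _ "(u, a, b)"]) auto
    qed simp
  next
    fix x assume "x \<in> ?f ` ?C \<union> ?L"
    then show "x \<in> {(u, v) \<in> ?P \<union> M. \<sigma> u \<noteq> \<sigma> v}"
    proof
      assume "x \<in> ?f ` ?C"
      then obtain u a b where "u < U" "(a, b) \<in> gadget_pairs" "x = (5 * u + a, 5 * u + b)"
        "\<sigma> (5 * u + a) \<noteq> \<sigma> (5 * u + b)" by auto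
      moreover from this have "x \<in> ?P" by (intro image_eqI[of _ _ "(u, a, b)"]) auto
      ultimately show ?thesis by simp
    qed auto
  qed
  also have "card \<dots> = card (?f ` ?C) + card {(p, q) \<in> M. \<sigma> p \<noteq> \<sigma> q}"
  proof (rule card_Un_disjoint)
    show "finite (?f ` ?C)" by (intro finite_imageI finite_SigmaI finite_lessThan fin)
    show "finite {(p, q) \<in> M. \<sigma> p \<noteq> \<sigma> q}" by (rule finite_subset[OF _ finite_links]) auto
    show "?f ` ?C \<inter> {(p, q) \<in> M. \<sigma> p \<noteq> \<sigma> q} = {}"
    proof -
      have "(5 * u + a, 5 * u + b) \<notin> M" if "(a, b) \<in> gadget_pairs" for u a b
        using link_less[of "5 * u + a" "5 * u + b"] gp[OF that] by auto
      then show ?thesis by auto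
    qed
  qed
  also have "card (?f ` ?C) = card ?C"
  proof (rule card_image, rule inj_onI)
    fix x y assume asm: "x \<in> ?C" "y \<in> ?C" "?f x = ?f y"
    obtain u a b u' a' b' where xy: "x = (u, a, b)" "y = (u', a', b')"
      by (metis prod_cases3)
    then have *: "a < 5" "a' < 5" "5 * u + a = 5 * u' + a'" "5 * u + b = 5 * u' + b'"
      using asm gp[of a b] gp[of a' b'] by simp_all
    then have "u = u'" by linarith
    with * xy show "x = y" by simp
  qed
  also have "card ?C = (\<Sum>u<U. gadget_cut (\<lambda>a. \<sigma> (5 * u + a)))"
    unfolding gadget_cut_def by (rule card_SigmaI) (simp_all add: fin)
  finally show ?thesis .
qed

definition broken_gadgets where
  "broken_gadgets \<sigma> = {u\<in>{..<U}. \<not> (\<sigma> (5 * u + 3) = \<sigma> (5 * u + 2) \<and> \<sigma> (5 * u + 4) = \<sigma> (5 * u + 2))}"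

definition uncut_links where
  "uncut_links \<sigma> = {(p, q) \<in> M. \<sigma> p = \<sigma> q}"

lemma card_cut_links: "card {(p, q) \<in> M. \<sigma> p \<noteq> \<sigma> q} + card (uncut_links \<sigma>) = card M"
proof -
  have eq: "{(p, q) \<in> M. \<sigma> p \<noteq> \<sigma> q} \<union> uncut_links \<sigma> = M" "{(p, q) \<in> M. \<sigma> p \<noteq> \<sigma> q} \<inter> uncut_links \<sigma> = {}"
    by (auto simp: uncut_links_def)
  then show ?thesis
    using finite_links eq
    by (subst card_Un_disjoint[symmetric]) (auto intro: finite_subset[OF _ finite_links] simp: uncut_links_def)
qed

text \<open>Every gadget cuts at most 6 edges, and by \<open>gadget_cut_le\<close> at most 5 if
  broken; every uncut link loses one more.\<close>

lemma card_cut_defects: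
  "card (cut G \<sigma>) + (card (broken_gadgets \<sigma>) + card (uncut_links \<sigma>)) \<le> 6 * U + card M"
proof -
  let ?b = "\<lambda>u. \<not> (\<sigma> (5 * u + 3) = \<sigma> (5 * u + 2) \<and> \<sigma> (5 * u + 4) = \<sigma> (5 * u + 2))"
  have "(\<Sum>u<U. of_bool (?b u)) = card (broken_gadgets \<sigma>)"
    by (simp only: sum_of_bool_eq finite_lessThan broken_gadgets_def of_nat_id Collect_conj_eq Collect_mem_eq)
  moreover have "(\<Sum>u<U. gadget_cut (\<lambda>a. \<sigma> (5 * u + a)) + of_bool (?b u)) \<le> (\<Sum>u<U. 6)"
    by (rule sum_mono) (rule gadget_cut_le)
  ultimately show ?thesis
    using card_cut_network[of \<sigma>] card_cut_links[of \<sigma>] by (simp only: sum.distrib sum_constant card_lessThan) simp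
qed

lemma card_cut_ground:
  assumes "\<And>u a. u < U \<Longrightarrow> a < 5 \<Longrightarrow> \<sigma> (5 * u + a) = ((a < 2) \<noteq> g u)"
    and "\<And>p q. (p, q) \<in> M \<Longrightarrow> \<sigma> p \<noteq> \<sigma> q"
  shows "card (cut G \<sigma>) = 6 * U + card M"
proof -
  have "uncut_links \<sigma> = {}"
    using assms(2) by (auto simp: uncut_links_def)
  moreover have "(\<Sum>u<U. gadget_cut (\<lambda>a. \<sigma> (5 * u + a))) = (\<Sum>u<U. 6)"
    using assms(1) by (intro sum.cong gadget_cut_ground) auto
  ultimately show ?thesis
    using card_cut_network[of \<sigma>] card_cut_links[of \<sigma>] by simp
qed

end

section \<open>Expanding permutations\<close>

text \<open>Double counting of the pairs \<open>(p, y)\<close> with \<open>y \<notin> T\<close>: composing \<open>p\<close> with the transposition of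
  \<open>x\<close> and \<open>y\<close> gives a \<open>q\<close> that maps \<open>T\<close> into \<open>S\<close> and sends \<open>y\<close> to \<open>S\<close>.\<close>

lemma card_permutations_into_insert:
  assumes "finite V" "S \<subseteq> V" "T \<subseteq> V" "x \<in> V" "x \<notin> T"
  shows "(card V - card T) * card {p. p permutes V \<and> p ` insert x T \<subseteq> S}
    \<le> (card S - card T) * card {p. p permutes V \<and> p ` T \<subseteq> S}"
proof -
  let ?F = "\<lambda>T. {p. p permutes V \<and> p ` T \<subseteq> S}"
  have fin: "finite (?F T)" for T
    by (rule finite_subset[OF _ finite_permutations[OF assms(1)]]) auto
  have finS: "finite S" "finite T" using assms finite_subset by auto
  \<comment> \<open>The fibre over \<open>q\<close> in the double count. Its size is the same for
    all \<open>q\<close>, as \<open>q\<close> takes every value in \<open>S\<close> and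
    \<open>card T\<close> of these on \<open>T\<close>.\<close>
  define Y where "Y q = {y\<in>V - T. q y \<in> S}" for q :: "'a \<Rightarrow> 'a"
  have cardY: "card (Y q) = card S - card T" if "q \<in> ?F T" for q
  proof -
    have q: "q permutes V" "q ` T \<subseteq> S" using that by auto
    have "q ` Y q = S - q ` T"
    proof
      show "q ` Y q \<subseteq> S - q ` T"
        using permutes_inj[OF q(1)] by (auto simp: Y_def dest: injD)
      show "S - q ` T \<subseteq> q ` Y q"
      proof
        fix z assume z: "z \<in> S - q ` T"
        then obtain y where "y \<in> V" "z = q y"
          using assms(2) permutes_image[OF q(1)] by blast
        then show "z \<in> q ` Y q" using z by (auto simp: Y_def)
      qed
    qed
    moreover have "inj_on q (Y q)" "inj_on q T"
      using permutes_inj[OF q(1)] by (auto intro: inj_on_subset)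
    ultimately have "card (Y q) = card (S - q ` T)" "card (q ` T) = card T"
      by (metis card_image)+
    then show ?thesis using q finS by (simp add: card_Diff_subset)
  qed
  \<comment> \<open>Keeping \<open>y\<close> in the second component lets the transposition be
    undone, which makes \<open>h\<close> injective.\<close>
  define h where "h = (\<lambda>(p :: 'a \<Rightarrow> 'a, y). (p \<circ> Transposition.transpose x y, y))"
  have "inj_on h (?F (insert x T) \<times> (V - T))"
  proof (rule inj_onI, clarsimp simp: h_def)
    fix p p' :: "'a \<Rightarrow> 'a" and y
    assume "p \<circ> Transposition.transpose x y = p' \<circ> Transposition.transpose x y"
    then have "p \<circ> Transposition.transpose x y \<circ> Transposition.transpose x y
      = p' \<circ> Transposition.transpose x y \<circ> Transposition.transpose x y" by simp
    then show "p = p'" by (simp add: comp_assoc)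
  qed
  moreover have "h ` (?F (insert x T) \<times> (V - T)) \<subseteq> Sigma (?F T) Y"
  proof (clarsimp simp: h_def)
    fix p y assume p: "p permutes V" "p x \<in> S" "p ` T \<subseteq> S" and y: "y \<in> V" "y \<notin> T"
    have "p \<circ> Transposition.transpose x y permutes V"
      using p(1) y assms by (intro permutes_compose permutes_swap_id)
    moreover have "p (Transposition.transpose x y z) = p z" if "z \<in> T" for z
      using that assms(5) y(2) by (metis transpose_apply_other)
    ultimately show "p \<circ> Transposition.transpose x y permutes V \<and>
      (\<lambda>z. p (Transposition.transpose x y z)) ` T \<subseteq> S \<and> y \<in> Y (p \<circ> Transposition.transpose x y)"
      using p y by (auto simp: Y_def)
  qed
  moreover have "finite (Sigma (?F T) Y)"
    using fin assms(1) by (auto simp: Y_def)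
  ultimately have "card (?F (insert x T) \<times> (V - T)) \<le> card (Sigma (?F T) Y)"
    by (meson card_inj_on_le)
  also have "card (?F (insert x T) \<times> (V - T)) = (card V - card T) * card (?F (insert x T))"
    using assms finS by (simp only: card_cartesian_product card_Diff_subset mult.commute)
  also have "card (Sigma (?F T) Y) = (\<Sum>q\<in>?F T. card (Y q))"
    using fin assms(1) by (intro card_SigmaI) (auto simp: Y_def)
  also have "\<dots> = (card S - card T) * card (?F T)"
    by (simp add: cardY)
  finally show ?thesis .
qed

text \<open>Given that \<open>T\<close> is sent into \<open>S\<close>, a further point lands in
  \<open>S\<close> with probability at most \<open>(card S - card T) / (card V - card T)\<close>,
  hence at most \<open>1 / k\<close>. The points of \<open>T\<close> are added one by one, with
  denominators multiplied out.\<close>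

lemma card_permutations_into:
  assumes "finite V" "S \<subseteq> V" "T \<subseteq> S" "card V = k * card S" "k \<ge> 1"
  shows "k ^ card T * card {p. p permutes V \<and> p ` T \<subseteq> S} \<le> fact (card V)"
proof -
  have "finite S" "finite T" using assms finite_subset by metis+
  from \<open>finite T\<close> \<open>T \<subseteq> S\<close> show ?thesis
  proof (induction T)
    case empty
    then show ?case using card_permutations[OF refl assms(1)] by simp
  next
    case (insert x T)
    let ?f = "\<lambda>T. card {p. p permutes V \<and> p ` T \<subseteq> S}"
    \<comment> \<open>Makes the common factor \<open>card S - card T\<close> positive, so that it
      can be cancelled below.\<close>
    have lt: "card T < card S"
      using insert \<open>finite S\<close> by (intro psubset_card_mono) auto
    have "k * (card S - card T) \<le> card V - card T"
      using assms(4,5) by (simp add: diff_mult_distrib2 diff_le_mono2)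
    then have "k * (card S - card T) * ?f (insert x T) \<le> (card V - card T) * ?f (insert x T)"
      by (rule mult_right_mono) simp
    also have "\<dots> \<le> (card S - card T) * ?f T"
      using insert assms by (intro card_permutations_into_insert) auto
    finally have "(card S - card T) * (k * ?f (insert x T)) \<le> (card S - card T) * ?f T"
      by (simp only: ac_simps)
    then have "k * ?f (insert x T) \<le> ?f T"
      using lt by (simp only: mult_le_cancel1 zero_less_diff)
    then have "k ^ card T * (k * ?f (insert x T)) \<le> k ^ card T * ?f T"
      by (rule mult_left_mono) simp
    also have "\<dots> \<le> fact (card V)" using insert by auto
    finally show ?case
      by (simp only: card_insert_disjoint[OF insert.hyps(1,2)] power_Suc mult.assoc mult.left_commute)
  qed
qed

text \<open>Union bound: a failing \<open>p\<close> keeps some \<open>T\<close> of size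
  \<open>t\<close> inside \<open>S\<close>. There are at most \<open>2 ^ s\<close> such
  \<open>T\<close>, each with probability at most \<open>16 ^ -t\<close>, and \<open>16 ^ t\<close>
  is at least \<open>4 ^ s\<close>.\<close>

lemma card_nonexpanding_permutations:
  assumes "finite V" "S \<subseteq> V" "card V = 16 * card S"
  shows "2 ^ card S * card {p. p permutes V \<and> 2 * card {x\<in>S. p x \<notin> S} < card S} \<le> fact (card V)"
proof -
  define s where "s = card S"
  \<comment> \<open>Half of \<open>s\<close> rounded up: small enough to be kept by a failing
    permutation, large enough for \<open>16 ^ t\<close> to beat \<open>4 ^ s\<close>.\<close>
  define t where "t = (s + 1) div 2"
  have "finite S" using assms finite_subset by auto
  let ?F = "\<lambda>T. {p. p permutes V \<and> p ` T \<subseteq> S}"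
  let ?B = "{p. p permutes V \<and> 2 * card {x\<in>S. p x \<notin> S} < card S}"
  let ?TT = "{T. T \<subseteq> S \<and> card T = t}"
  have "?B \<subseteq> (\<Union>T\<in>?TT. ?F T)"
  proof
    fix p assume p: "p \<in> ?B"
    have "card S = card {x\<in>S. p x \<notin> S} + card {x\<in>S. p x \<in> S}"
      using \<open>finite S\<close> by (subst card_Un_disjoint[symmetric]) (auto intro: arg_cong[of _ _ card])
    then have "t \<le> card {x\<in>S. p x \<in> S}" using p by (auto simp: t_def s_def)
    then obtain T where "T \<subseteq> {x\<in>S. p x \<in> S}" "card T = t"
      by (meson obtain_subset_with_card_n)
    then show "p \<in> (\<Union>T\<in>?TT. ?F T)" using p by auto
  qed
  then have "card ?B \<le> card (\<Union>T\<in>?TT. ?F T)"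
    by (rule card_mono[rotated])
      (use assms(1) \<open>finite S\<close> in \<open>auto intro!: finite_UN_I finite_subset[OF _ finite_permutations[OF assms(1)]]\<close>)
  also have "\<dots> \<le> (\<Sum>T\<in>?TT. card (?F T))"
    using \<open>finite S\<close> by (intro card_UN_le) auto
  finally have "16 ^ t * card ?B \<le> (\<Sum>T\<in>?TT. 16 ^ t * card (?F T))"
    by (simp only: sum_distrib_left[symmetric] mult_le_mono2)
  also have "\<dots> \<le> (\<Sum>T\<in>?TT. fact (card V))"
    using card_permutations_into[OF assms(1,2) _ assms(3)] by (intro sum_mono) auto
  also have "\<dots> \<le> 2 ^ s * fact (card V)"
  proof -
    have "card ?TT \<le> card (Pow S)" using \<open>finite S\<close> by (intro card_mono) auto
    then show ?thesis using \<open>finite S\<close> by (simp add: card_Pow s_def)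
  qed
  finally have "16 ^ t * card ?B \<le> 2 ^ s * fact (card V)" .
  moreover have "(2::nat) ^ s * 2 ^ s \<le> 16 ^ t"
  proof -
    have "(2::nat) ^ s * 2 ^ s = 2 ^ (2 * s)" by (simp add: power_add[symmetric] mult_2)
    also have "\<dots> \<le> 2 ^ (4 * t)" by (intro power_increasing) (auto simp: t_def)
    also have "\<dots> = 16 ^ t" by (simp add: power_mult)
    finally show ?thesis .
  qed
  ultimately have "2 ^ s * 2 ^ s * card ?B \<le> 2 ^ s * fact (card V)"
    by (meson le_trans mult_le_mono1)
  then have "2 ^ s * (2 ^ s * card ?B) \<le> 2 ^ s * fact (card V)" by (simp only: mult.assoc)
  then show ?thesis by (simp add: s_def)
qed

text \<open>For a fixed \<open>S\<close>, 17 independent random permutations all fail with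
  probability at most \<open>2 ^ -(17 * s)\<close>, while there are at most
  \<open>2 ^ (16 * s)\<close> sets. The argument counts 17-tuples of permutations.\<close>

lemma expanding_permutations_exist:
  fixes V :: "'a set"
  assumes "finite V" "card V = 16 * s"
  shows "\<exists>\<pi>. (\<forall>i. \<pi> i permutes V) \<and>
    (\<forall>S\<subseteq>V. card S = s \<longrightarrow> (\<exists>i<17::nat. s \<le> 2 * card {x\<in>S. \<pi> i x \<notin> S}))"
proof (cases "s = 0")
  \<comment> \<open>The final comparison of \<open>2 ^ (17 * s)\<close> with
    \<open>2 ^ (16 * s)\<close> is strict only for positive \<open>s\<close>.\<close>
  case True
  then show ?thesis by (intro exI[of _ "\<lambda>_. id"]) (auto simp: permutes_id intro: exI[of _ 0])
next
  case False
  let ?P = "{p. p permutes V}"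
  let ?SS = "{S. S \<subseteq> V \<and> card S = s}"
  define B where "B S = {p. p permutes V \<and> 2 * card {x\<in>S. p x \<notin> S} < card S}" for S
  let ?I = "{..<17::nat}"
  have finP: "finite ?P" using assms(1) by (rule finite_permutations)
  have finB: "finite (B S)" for S by (rule finite_subset[OF _ finP]) (auto simp: B_def)
  have "\<not> (?I \<rightarrow>\<^sub>E ?P) \<subseteq> (\<Union>S\<in>?SS. ?I \<rightarrow>\<^sub>E B S)"
  proof
    assume "(?I \<rightarrow>\<^sub>E ?P) \<subseteq> (\<Union>S\<in>?SS. ?I \<rightarrow>\<^sub>E B S)"
    then have "card (?I \<rightarrow>\<^sub>E ?P) \<le> card (\<Union>S\<in>?SS. ?I \<rightarrow>\<^sub>E B S)"
      using assms(1) finB by (intro card_mono) (auto intro!: finite_PiE)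
    also have "\<dots> \<le> (\<Sum>S\<in>?SS. card (?I \<rightarrow>\<^sub>E B S))"
      using assms(1) by (intro card_UN_le) auto
    also have "\<dots> = (\<Sum>S\<in>?SS. card (B S) ^ 17)" by (simp add: card_funcsetE)
    finally have "(2 ^ s) ^ 17 * fact (card V) ^ 17 \<le> (\<Sum>S\<in>?SS. (2 ^ s * card (B S)) ^ 17)"
      using card_permutations[OF refl assms(1)]
      by (simp add: card_funcsetE power_mult_distrib sum_distrib_left[symmetric])
    also have "\<dots> \<le> (\<Sum>S\<in>?SS. fact (card V) ^ 17)"
    proof (intro sum_mono power_mono)
      fix S assume "S \<in> ?SS"
      then show "2 ^ s * card (B S) \<le> fact (card V)"
        using card_nonexpanding_permutations[OF assms(1), of S] assms(2) by (auto simp: B_def)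
    qed simp
    also have "\<dots> \<le> 2 ^ card V * fact (card V) ^ 17"
    proof -
      have "card ?SS \<le> card (Pow V)" using assms(1) by (intro card_mono) auto
      then show ?thesis using assms(1) by (simp add: card_Pow)
    qed
    finally have "(2::nat) ^ (17 * s) \<le> 2 ^ (16 * s)"
      by (simp add: assms(2) power_mult[symmetric] mult.commute)
    then show False using False by simp
  qed
  then obtain f where f: "f \<in> ?I \<rightarrow>\<^sub>E ?P" "\<And>S. S \<in> ?SS \<Longrightarrow> f \<notin> ?I \<rightarrow>\<^sub>E B S" by blast
  \<comment> \<open>The identity fills the indices from 17 on, so that every \<open>\<pi> i\<close>
    is a permutation.\<close>
  define \<pi> where "\<pi> i = (if i < 17 then f i else id)" for i
  have "\<pi> i permutes V" for i
    using f(1) by (auto simp: \<pi>_def permutes_id PiE_def)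
  moreover have "\<exists>i<17. s \<le> 2 * card {x\<in>S. \<pi> i x \<notin> S}" if S: "S \<subseteq> V" "card S = s" for S
  proof -
    obtain i where "i < 17" "f i \<notin> B S"
      using f(2)[of S] f(1) S by (auto simp: PiE_def Pi_def)
    then show ?thesis using f(1) S by (intro exI[of _ i]) (auto simp: \<pi>_def B_def PiE_def)
  qed
  ultimately show ?thesis by blast
qed

section \<open>The expanding network\<close>

text \<open>Vertex \<open>a\<close> of the gadget in row \<open>j < 2d\<close> of column \<open>x < N\<close>. Since an optimal cut separates
  the ends of a link but not the ports of a gadget, spins alternate along a column; hence the cross
  links below join even rows to odd rows.\<close>

definition vtx :: "nat \<Rightarrow> nat \<Rightarrow> nat \<Rightarrow> nat \<Rightarrow> nat" where
  "vtx N j x a = 5 * (j * N + x) + a"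

text \<open>Each port has one task: 3 leads to the next row, 2 to the previous one, and 4 carries
  the cross link. Hence no port has two links.\<close>

definition column_links :: "nat \<Rightarrow> nat \<Rightarrow> (nat \<times> nat) set" where
  "column_links d N = {(vtx N j x 3, vtx N (Suc j) x 2) | j x. Suc j < 2 * d \<and> x < N}"

definition cross_links :: "nat \<Rightarrow> nat \<Rightarrow> (nat \<Rightarrow> nat \<Rightarrow> nat) \<Rightarrow> (nat \<times> nat) set" where
  "cross_links d N \<pi> = {(vtx N (2 * i) x 4, vtx N (Suc (2 * i)) (\<pi> i x) 4) | i x. i < d \<and> x < N}"

locale permutation_network =
  fixes V d N :: nat and \<pi> :: "nat \<Rightarrow> nat \<Rightarrow> nat"
  assumes fits: "10 * d * N \<le> V" and perm: "\<pi> i permutes {..<N}"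
begin

abbreviation links where "links \<equiv> column_links d N \<union> cross_links d N \<pi>"

lemma perm_less: "\<pi> i x < N \<longleftrightarrow> x < N"
  using permutes_in_image[OF perm[of i], of x] by simp

lemma vtx_coords:
  assumes "a < 5" "x < N"
  shows "vtx N j x a div 5 = j * N + x" "vtx N j x a mod 5 = a"
    "vtx N j x a div 5 div N = j" "vtx N j x a div 5 mod N = x"
proof -
  show *: "vtx N j x a div 5 = j * N + x" "vtx N j x a mod 5 = a"
    unfolding vtx_def using assms(1) by (simp_all only: mod_mult_self4) auto
  show "vtx N j x a div 5 div N = j" "vtx N j x a div 5 mod N = x"
    unfolding * using assms(2) by simp_all
qed

lemma gadget_index_less: "j < 2 * d \<Longrightarrow> x < N \<Longrightarrow> j * N + x < 2 * d * N"
  using mult_le_mono1[of "Suc j" "2 * d" N] by simp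

lemma link_cases:
  assumes "(p, q) \<in> links"
  obtains (column) j x where "Suc j < 2 * d" "x < N" "p = vtx N j x 3" "q = vtx N (Suc j) x 2"
  | (cross) i x where "i < d" "x < N" "p = vtx N (2 * i) x 4" "q = vtx N (Suc (2 * i)) (\<pi> i x) 4"
  using assms unfolding column_links_def cross_links_def by blast

text \<open>The link partner as a function, from which \<open>link_unique\<close> follows. At
  vertices without a link its value has no meaning.\<close>

definition mate where
  "mate v = (let j = v div 5 div N; x = v div 5 mod N in
     if v mod 5 = 2 then vtx N (j - 1) x 3
     else if v mod 5 = 3 then vtx N (Suc j) x 2
     else if even j then vtx N (Suc j) (\<pi> (j div 2) x) 4
     else vtx N (j - 1) (inv (\<pi> (j div 2)) x) 4)"

lemma link_mate:
  assumes "(p, q) \<in> links"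
  shows "q = mate p \<and> p = mate q"
  using assms
proof (cases rule: link_cases)
  case (column j x)
  then show ?thesis by (simp add: mate_def vtx_coords del: mult_Suc)
next
  case (cross i x)
  then show ?thesis
    using perm_less[of i x] permutes_inverses(2)[OF perm[of i]] by (simp add: mate_def vtx_coords del: mult_Suc)
qed

sublocale linked_gadgets V "2 * d * N" links
proof
  show "5 * (2 * d * N) \<le> V" using fits by simp
  have links: "p div 5 < q div 5 \<and> q div 5 < 2 * d * N \<and> 2 \<le> p mod 5 \<and> 2 \<le> q mod 5"
    if "(p, q) \<in> links" for p q
    using that
  proof (cases rule: link_cases)
    case (column j x)
    then show ?thesis using gadget_index_less[of "Suc j" x] by (simp add: vtx_coords)
  next
    case (cross i x)
    then show ?thesis
      using perm_less[of i x] gadget_index_less[of "Suc (2 * i)" "\<pi> i x"] by (simp add: vtx_coords)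
  qed
  show "p div 5 < q div 5" "q div 5 < 2 * d * N" "2 \<le> p mod 5 \<and> 2 \<le> q mod 5"
    if "(p, q) \<in> links" for p q
    using links[OF that] by simp_all
  show "w = w'" if "(v, w) \<in> links \<or> (w, v) \<in> links" "(v, w') \<in> links \<or> (w', v) \<in> links" for v w w'
    using that link_mate by metis
qed

section \<open>Defects and column spins\<close>

definition defect_columns where
  "defect_columns \<sigma> = (\<lambda>u. u mod N) ` broken_gadgets \<sigma> \<union> (\<lambda>(p, q). p div 5 mod N) ` uncut_links \<sigma>"

lemma finite_broken: "finite (broken_gadgets \<sigma>)"
  by (simp add: broken_gadgets_def)

lemma finite_uncut: "finite (uncut_links \<sigma>)"
  by (rule finite_subset[OF _ finite_links]) (auto simp: uncut_links_def)

text \<open>An uncut link is charged only to the column of its first end, so each defect spoils at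
  most one column.\<close>

lemma card_defect_columns: "card (defect_columns \<sigma>) \<le> card (broken_gadgets \<sigma>) + card (uncut_links \<sigma>)"
  unfolding defect_columns_def
  by (rule order_trans[OF card_Un_le]) (intro add_mono card_image_le finite_broken finite_uncut)

lemma finite_defect_columns: "finite (defect_columns \<sigma>)"
  by (simp add: defect_columns_def finite_broken finite_uncut)

lemma clean_gadget:
  assumes "x \<notin> defect_columns \<sigma>" "x < N" "j < 2 * d"
  shows "\<sigma> (vtx N j x 3) = \<sigma> (vtx N j x 2)" "\<sigma> (vtx N j x 4) = \<sigma> (vtx N j x 2)"
proof -
  have "j * N + x \<notin> broken_gadgets \<sigma>"
  proof
    assume "j * N + x \<in> broken_gadgets \<sigma>"
    then have "(j * N + x) mod N \<in> defect_columns \<sigma>"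
      unfolding defect_columns_def by (intro UnI1 imageI)
    then show False using assms by simp
  qed
  then show "\<sigma> (vtx N j x 3) = \<sigma> (vtx N j x 2)" "\<sigma> (vtx N j x 4) = \<sigma> (vtx N j x 2)"
    using gadget_index_less[OF assms(3,2)] by (auto simp: broken_gadgets_def vtx_def)
qed

lemma clean_link:
  assumes "(p, q) \<in> links" "p div 5 mod N \<notin> defect_columns \<sigma>"
  shows "\<sigma> p \<noteq> \<sigma> q"
proof
  assume "\<sigma> p = \<sigma> q"
  then have "(p, q) \<in> uncut_links \<sigma>" using assms(1) by (simp add: uncut_links_def)
  then have "(\<lambda>(p, q). p div 5 mod N) (p, q) \<in> defect_columns \<sigma>"
    unfolding defect_columns_def by blast
  then show False using assms(2) by simp
qed

text \<open>In a clean column each gadget copies the spin from port 2 to port 3 and each column link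
  inverts it.\<close>

lemma clean_column:
  assumes "x \<notin> defect_columns \<sigma>" "x < N" "j < 2 * d"
  shows "\<sigma> (vtx N j x 2) = (\<sigma> (vtx N 0 x 2) \<noteq> odd j)"
  using assms(3)
proof (induction j)
  case (Suc j)
  have "(vtx N j x 3, vtx N (Suc j) x 2) \<in> links"
    using Suc.prems assms(2) by (auto simp: column_links_def)
  then have "\<sigma> (vtx N j x 3) \<noteq> \<sigma> (vtx N (Suc j) x 2)"
    using assms(1,2) by (intro clean_link) (simp_all add: vtx_coords)
  then show ?case
    using Suc clean_gadget(1)[OF assms(1,2), of j] by auto
qed simp

text \<open>The inversion along the cross link is compensated by the opposite parities of the rows
  \<open>2 * i\<close> and \<open>Suc (2 * i)\<close>.\<close>

lemma clean_cross:
  fixes \<sigma> :: "nat \<Rightarrow> bool"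
  assumes "x \<notin> defect_columns \<sigma>" "\<pi> i x \<notin> defect_columns \<sigma>" "x < N" "i < d"
  shows "\<sigma> (vtx N 0 x 2) = \<sigma> (vtx N 0 (\<pi> i x) 2)"
proof -
  have "\<pi> i x < N" using assms(3) perm_less by simp
  have "(vtx N (2 * i) x 4, vtx N (Suc (2 * i)) (\<pi> i x) 4) \<in> links"
    using assms by (auto simp: cross_links_def)
  then have "\<sigma> (vtx N (2 * i) x 4) \<noteq> \<sigma> (vtx N (Suc (2 * i)) (\<pi> i x) 4)"
    using assms by (intro clean_link) (simp_all add: vtx_coords)
  then show ?thesis
    using assms \<open>\<pi> i x < N\<close> clean_gadget(2)[of x \<sigma> "2 * i"] clean_gadget(2)[of "\<pi> i x" \<sigma> "Suc (2 * i)"]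
      clean_column[of x \<sigma> "2 * i"] clean_column[of "\<pi> i x" \<sigma> "Suc (2 * i)"] by auto
qed

text \<open>The column spin is read at one vertex, even in defective columns, so that a single flip
  changes the count by at most one.\<close>

definition plus_columns where
  "plus_columns \<sigma> = {x\<in>{..<N}. \<sigma> (vtx N 0 x 2)}"

text \<open>By \<open>clean_cross\<close>, an exit at \<open>x\<close> requires a defect in column
  \<open>x\<close> or in column \<open>\<pi> i x\<close>.\<close>

lemma card_exits_le_defects:
  assumes "i < d"
  shows "card {x\<in>plus_columns \<sigma>. \<pi> i x \<notin> plus_columns \<sigma>} \<le> 2 * card (defect_columns \<sigma>)"
proof -
  let ?D = "defect_columns \<sigma>"
  have "{x\<in>plus_columns \<sigma>. \<pi> i x \<notin> plus_columns \<sigma>} \<subseteq> ?D \<union> (inv (\<pi> i)) ` ?D"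
  proof
    fix x assume x: "x \<in> {x\<in>plus_columns \<sigma>. \<pi> i x \<notin> plus_columns \<sigma>}"
    then have "x \<in> ?D \<or> \<pi> i x \<in> ?D"
      using clean_cross[of x \<sigma> i] assms by (auto simp: plus_columns_def perm_less)
    moreover have "x = inv (\<pi> i) (\<pi> i x)"
      using permutes_inverses(2)[OF perm] by simp
    ultimately show "x \<in> ?D \<union> (inv (\<pi> i)) ` ?D" by blast
  qed
  then have "card {x\<in>plus_columns \<sigma>. \<pi> i x \<notin> plus_columns \<sigma>} \<le> card (?D \<union> (inv (\<pi> i)) ` ?D)"
    by (rule card_mono[rotated]) (simp add: finite_defect_columns)
  also have "\<dots> \<le> card ?D + card ?D"
    by (rule order_trans[OF card_Un_le]) (intro add_mono order_refl card_image_le finite_defect_columns)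
  finally show ?thesis by simp
qed

text \<open>The optimal configuration without plus columns: ports in row \<open>j\<close> have spin
  \<open>odd j\<close>, starting with minus in row 0.\<close>

definition ground where
  "ground = restrict (\<lambda>v. (v mod 5 < 2) \<noteq> odd (v div 5 div N)) {..<V}"

lemma ground_config: "ground \<in> configs G"
  by (simp add: ground_def configs_def)

lemma ground_vtx:
  assumes "j < 2 * d" "x < N" "a < 5"
  shows "ground (vtx N j x a) = ((a < 2) \<noteq> odd j)"
proof -
  have "vtx N j x a < V"
    using gadget_index_less[OF assms(1,2)] assms(3) size by (simp add: vtx_def)
  then show ?thesis using assms by (simp add: ground_def vtx_coords)
qed

lemma card_cut_ground_config: "card (cut G ground) = 6 * (2 * d * N) + card links"
proof (rule card_cut_ground)
  show "ground (5 * u + a) = ((a < 2) \<noteq> odd (u div N))" if "u < 2 * d * N" "a < 5" for u a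
  proof -
    have "5 * u + a < V" using that size by linarith
    then show ?thesis using that(2) by (simp add: ground_def)
  qed
  show "ground p \<noteq> ground q" if "(p, q) \<in> links" for p q
    using that by (cases rule: link_cases) (simp_all add: ground_vtx perm_less)
qed

end

section \<open>Cost of the interface and the mixing time\<close>

locale expanding_network = permutation_network +
  fixes s :: nat
  assumes d_pos: "0 < d" and s_small: "2 * s < N"
    and expanding: "\<And>S. S \<subseteq> {..<N} \<Longrightarrow> card S = s \<Longrightarrow> \<exists>i<d. s \<le> 2 * card {x\<in>S. \<pi> i x \<notin> S}"
begin

text \<open>Expansion loses a factor 2 and passing from exits to defect columns another, so there
  are at least \<open>s / 4\<close> defects. Taking \<open>\<mu> = \<beta> ^ 4\<close> keeps the
  exponents integral.\<close>

lemma wt_interface: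
  assumes "\<beta> \<ge> 1" "card (plus_columns \<sigma>) = s"
  shows "\<beta> ^ s * wt G (\<beta> ^ 4) \<sigma> \<le> wt G (\<beta> ^ 4) ground"
proof -
  obtain i where "i < d" "s \<le> 2 * card {x\<in>plus_columns \<sigma>. \<pi> i x \<notin> plus_columns \<sigma>}"
    using expanding[OF _ assms(2)] by (auto simp: plus_columns_def)
  then have "s \<le> 4 * card (defect_columns \<sigma>)"
    using card_exits_le_defects[of i \<sigma>] by linarith
  then have "s + 4 * card (cut G \<sigma>) \<le> 4 * card (cut G ground)"
    using card_defect_columns[of \<sigma>] card_cut_defects[of \<sigma>] card_cut_ground_config by linarith
  then have "\<beta> ^ (s + 4 * card (cut G \<sigma>)) \<le> \<beta> ^ (4 * card (cut G ground))"
    using assms(1) by (rule power_increasing)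
  then show ?thesis by (simp add: wt_def power_add power_mult)
qed

text \<open>The bottleneck is \<open>B\<close>, with exactly \<open>s\<close> plus columns. The
  factor \<open>2 ^ V\<close> is a crude bound on its number of configurations.\<close>

theorem mixing_time_lower_bound:
  fixes \<beta> :: real
  assumes "\<beta> \<ge> 1"
  shows "\<beta> ^ s \<le> 4 * 2 ^ V * real (mixing_time G (\<beta> ^ 4))"
proof -
  let ?\<mu> = "\<beta> ^ 4"
  have "0 < N" using s_small by simp
  then have "0 < 10 * d * N" using d_pos by simp
  then have "0 < V" using fits by linarith
  interpret ising G ?\<mu>
    using assms \<open>0 < V\<close> by unfold_locales (auto simp: lessThan_empty_iff)
  define A where "A = {\<sigma>\<in>configs G. card (plus_columns \<sigma>) \<le> s}"
  define B where "B = {\<sigma>\<in>configs G. card (plus_columns \<sigma>) = s}"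
  have fin_plus: "finite (plus_columns \<sigma>)" for \<sigma> by (simp add: plus_columns_def)
  have "plus_columns ground = {}"
    using d_pos by (auto simp: plus_columns_def ground_vtx)
  then have "ground \<in> A" using ground_config by (simp add: A_def)
  moreover have "A \<subseteq> configs G" "B \<subseteq> A" by (auto simp: A_def B_def)
  moreover have "\<sigma> \<in> B" if "\<sigma> \<in> A" "v \<in> verts G" "flip \<sigma> v \<notin> A" for \<sigma> v
  proof -
    \<comment> \<open>The vertex \<open>vtx N 0 x 2\<close> is \<open>5 * x + 2\<close>, so
      \<open>v div 5\<close> is the only column that a flip at \<open>v\<close> can affect.\<close>
    have "plus_columns (flip \<sigma> v) \<subseteq> insert (v div 5) (plus_columns \<sigma>)"
      by (auto simp: plus_columns_def flip_def vtx_def split: if_splits)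
    then have "card (plus_columns (flip \<sigma> v)) \<le> card (insert (v div 5) (plus_columns \<sigma>))"
      using fin_plus by (intro card_mono) auto
    also have "\<dots> \<le> Suc (card (plus_columns \<sigma>))" by (rule card_insert_le_m1) simp_all
    finally have "card (plus_columns (flip \<sigma> v)) \<le> Suc (card (plus_columns \<sigma>))" .
    then show ?thesis
      using that flip_in_configs[of \<sigma> G v] by (auto simp: A_def B_def)
  qed
  moreover have "2 * (\<Sum>\<sigma>\<in>A. wt G ?\<mu> \<sigma>) \<le> partition_function G ?\<mu>"
  proof (rule half_by_symmetry[OF simple_network \<open>A \<subseteq> configs G\<close>])
    fix \<sigma> assume "\<sigma> \<in> A"
    let ?n = "restrict (\<lambda>v. \<not> \<sigma> v) (verts G)"
    \<comment> \<open>The spins read by \<open>plus_columns\<close> lie in the vertex set, where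
      \<open>restrict\<close> really negates them; so \<open>c\<close> plus columns become
      \<open>N - c\<close>, which exceeds \<open>s\<close>.\<close>
    have "vtx N 0 x 2 < V" if "x < N" for x
      using gadget_index_less[of 0 x] d_pos that size by (simp add: vtx_def)
    then have "plus_columns ?n = {..<N} - plus_columns \<sigma>"
      by (auto simp: plus_columns_def)
    moreover have "plus_columns \<sigma> \<subseteq> {..<N}" by (auto simp: plus_columns_def)
    ultimately have "card (plus_columns ?n) = N - card (plus_columns \<sigma>)"
      using fin_plus by (simp add: card_Diff_subset)
    then show "?n \<notin> A" using \<open>\<sigma> \<in> A\<close> s_small by (auto simp: A_def)
  qed
  ultimately have "wt G ?\<mu> ground \<le> 4 * real (mixing_time G ?\<mu>) * (\<Sum>\<sigma>\<in>B. wt G ?\<mu> \<sigma>)"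
    by (rule mixing_time_bottleneck)
  then have "\<beta> ^ s * wt G ?\<mu> ground \<le> 4 * real (mixing_time G ?\<mu>) * (\<Sum>\<sigma>\<in>B. \<beta> ^ s * wt G ?\<mu> \<sigma>)"
    using assms by (simp add: sum_distrib_left[symmetric] mult.left_commute[of _ "\<beta> ^ s"] mult_left_mono)
  also have "\<dots> \<le> 4 * real (mixing_time G ?\<mu>) * (\<Sum>\<sigma>\<in>B. wt G ?\<mu> ground)"
    using assms by (intro mult_left_mono sum_mono wt_interface) (auto simp: B_def)
  also have "\<dots> \<le> 4 * real (mixing_time G ?\<mu>) * (2 ^ V * wt G ?\<mu> ground)"
  proof -
    have "card B \<le> card (configs G)"
      using fin_configs by (intro card_mono) (auto simp: B_def)
    also have "\<dots> = 2 ^ V" by (simp add: configs_def card_PiE)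
    finally have "real (card B) \<le> 2 ^ V" by (simp flip: of_nat_le_iff)
    then show ?thesis
      using less_imp_le[OF wt_gt0] by (intro mult_left_mono) (auto intro: mult_right_mono)
  qed
  finally have "\<beta> ^ s * wt G ?\<mu> ground \<le> (4 * 2 ^ V * real (mixing_time G ?\<mu>)) * wt G ?\<mu> ground"
    by (simp add: ac_simps)
  then show ?thesis
    using wt_gt0[of ground] by (simp only: mult_le_cancel_right_pos)
qed

end

section \<open>Choice of the parameters\<close>

theorem theorem4:
  "\<exists>\<mu>::real. \<mu> > 1 \<and>
     (\<exists>G :: nat \<Rightarrow> nat ugraph.
        (\<forall>n. simple_graph (G n) \<and> quasi_line (G n) \<and>
             (\<forall>v\<in>verts (G n). vertex_degree (G n) v \<le> 8) \<and>
             card (verts (G n)) = 18 * n) \<and>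
        (\<lambda>n. real (mixing_time (G n) \<mu>)) \<in> \<Omega>(\<lambda>n. 2 ^ n))"
proof -
  \<comment> \<open>With \<open>d = 17\<close> and \<open>N = 16 * s n\<close> the gadgets occupy
    \<open>10 * 17 * 16 * s n = 2720 * s n\<close> vertices, which must not exceed
    \<open>18 * n\<close>.\<close>
  define s where "s n = 9 * n div 1360" for n :: nat
  \<comment> \<open>As \<open>4080 = 3 * 1360\<close>, the gain \<open>\<beta> ^ s n\<close> is
    about \<open>2 ^ (27 * n)\<close>. It has to cover \<open>2 ^ (18 * n)\<close> configurations
    and the target \<open>2 ^ n\<close>.\<close>
  define \<beta> :: real where "\<beta> = 2 ^ 4080"
  have "\<beta> > 1" unfolding \<beta>_def by (rule one_less_power) simp_all
  define good where "good n \<pi> \<longleftrightarrow> (\<forall>i. \<pi> i permutes {..<16 * s n}) \<and>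
    (\<forall>S\<subseteq>{..<16 * s n}. card S = s n \<longrightarrow> (\<exists>i<17. s n \<le> 2 * card {x\<in>S. \<pi> i x \<notin> S}))"
    for n and \<pi> :: "nat \<Rightarrow> nat \<Rightarrow> nat"
  have "\<exists>\<pi>. good n \<pi>" for n
    unfolding good_def by (rule expanding_permutations_exist) simp_all
  then obtain \<pi> where good: "good n (\<pi> n)" for n by metis
  define G where "G n = network (18 * n) (2 * 17 * (16 * s n))
    (column_links 17 (16 * s n) \<union> cross_links 17 (16 * s n) (\<pi> n))" for n
  have net: "permutation_network (18 * n) 17 (16 * s n) (\<pi> n)" for n
    using good[of n] by unfold_locales (auto simp: good_def s_def)
  \<comment> \<open>For \<open>n\<close> at least 1000, the surplus of 27 over 19 absorbs the
    rounding in \<open>s n\<close>, and \<open>s n\<close> is positive.\<close>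
  have lower: "1 / 4 * 2 ^ n \<le> real (mixing_time (G n) (\<beta> ^ 4))" if "n \<ge> 1000" for n
  proof -
    have "s n > 0" and exponent: "19 * n \<le> 4080 * s n"
      using that unfolding s_def by linarith+
    have "expanding_network (18 * n) 17 (16 * s n) (\<pi> n) (s n)"
      using net good[of n] \<open>s n > 0\<close>
      by (intro expanding_network.intro expanding_network_axioms.intro) (auto simp: good_def)
    then have "\<beta> ^ s n \<le> 4 * 2 ^ (18 * n) * real (mixing_time (G n) (\<beta> ^ 4))"
      using expanding_network.mixing_time_lower_bound \<open>\<beta> > 1\<close> unfolding G_def by (metis less_imp_le)
    moreover have "(2::real) ^ (n + 18 * n) \<le> 2 ^ (4080 * s n)"
      using exponent by (intro power_increasing) auto
    moreover have "2 ^ (4080 * s n) = \<beta> ^ s n"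
      unfolding \<beta>_def by (rule power_mult)
    ultimately have "2 ^ n * 2 ^ (18 * n) \<le> (4 * real (mixing_time (G n) (\<beta> ^ 4))) * (2 ^ (18 * n) :: real)"
      by (simp only: power_add ac_simps)
    then have "2 ^ n \<le> 4 * real (mixing_time (G n) (\<beta> ^ 4))"
      by (simp only: mult_le_cancel_right_pos zero_less_power zero_less_numeral)
    then show ?thesis by simp
  qed
  have "(\<lambda>n. real (mixing_time (G n) (\<beta> ^ 4))) \<in> \<Omega>(\<lambda>n. 2 ^ n)"
    using lower by (intro landau_omega.bigI[of "1 / 4"] eventually_sequentiallyI[of 1000]) simp_all
  moreover have "simple_graph (G n) \<and> quasi_line (G n) \<and>
      (\<forall>v\<in>verts (G n). vertex_degree (G n) v \<le> 8) \<and> card (verts (G n)) = 18 * n" for n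
  proof -
    \<comment> \<open>The structural claims hold for every \<open>n\<close>, including small
      \<open>n\<close> with \<open>s n = 0\<close>, where the graph has no edges.\<close>
    interpret permutation_network "18 * n" 17 "16 * s n" "\<pi> n" by (rule net)
    show ?thesis
      unfolding G_def
      by (intro conjI ballI simple_network quasi_line_network order_trans[OF degree_network])
        (simp_all add: network_def)
  qed
  moreover have "\<beta> ^ 4 > 1" using \<open>\<beta> > 1\<close> by (intro one_less_power) simp_all
  ultimately show ?thesis by blast
qed

end
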